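(* For any $(a,b,c,\lambda,\delta),(\bar a,\bar b,\bar c,\bar\lambda,\bar\delta)\in(\mathbb F^\times)^4\times\mathbb F$ the following are equivalent: (i) $(a,b,c,\lambda,\delta)\simeq_{\pm,\mathfrak S_4}(\bar a,\bar b,\bar c,\bar\lambda,\bar\delta)$; (ii) there is a $\triangle_q$-module homomorphism $W_\lambda^\delta(a,b,c)\to W_{\bar\lambda}^{\bar\delta}(\bar a,\bar b,\bar c)$ sending $w_0$ to $\bar w_0$; (iii) there is a $\triangle_q$-module homomorphism $W_{\bar\lambda}^{\bar\delta}(\bar a,\bar b,\bar c)\to W_\lambda^\delta(a,b,c)$ sending $\bar w_0$ to $w_0$; (iv) there is a $\triangle_q$-module isomorphism $W_\lambda^\delta(a,b,c)\to W_{\bar\lambda}^{\bar\delta}(\bar a,\bar b,\bar c)$ sending $w_0$ to $\bar w_0$; (v) there is a $\triangle_q$-module isomorphism $W_{\bar\lambda}^{\bar\delta}(\bar a,\bar b,\bar c)\to W_\lambda^\delta(a,b,c)$ sending $\bar w_0$ to $w_0$.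
   Context: $\mathbb F$ is an algebraically closed field and $q\in\mathbb F^\times$ a root of unity of order $d\notin\{1,2,4\}$; $d'=d$ if $d$ odd, $d'=d/2$ if $d$ even; $\sqrt{x}$ is a fixed square root. $\triangle_q$ is the unital associative $\mathbb F$-algebra with generators $A,B,C$ subject to: each of $A+\frac{qBC-q^{-1}CB}{q^2-q^{-2}}$, $B+\frac{qCA-q^{-1}AC}{q^2-q^{-2}}$, $C+\frac{qAB-q^{-1}BA}{q^2-q^{-2}}$ is central; $\alpha,\beta,\gamma$ are these times $q+q^{-1}$. For $(a,b,c,\lambda)\in(\mathbb F^\times)^4$, $i\in\mathbb N$: $\theta_i=a\lambda^{-1}q^{2i}+a^{-1}\lambda q^{-2i}$, $\theta_i^*=b\lambda^{-1}q^{2i}+b^{-1}\lambda q^{-2i}$, $\varphi_i=a^{-1}b^{-1}\lambda q(q^i-q^{-i})(\lambda^{-1}q^{i-1}-\lambda q^{1-i})(q^{-i}-abc\lambda^{-1}q^{i-1})(q^{-i}-abc^{-1}\lambda^{-1}q^{i-1})$. $M_\lambda(a,b,c)$ has basis $\{m_i\}_{i\in\mathbb N}$, $(A-\theta_i)m_i=m_{i+1}$, $(B-\theta_i^* )m_i=\varphi_im_{i-1}$, $\alpha,\beta,\gamma$ acting as $(b+b^{-1})(c+c^{-1})+(a+a^{-1})(\lambda q+\lambda^{-1}q^{-1})$, $(c+c^{-1})(a+a^{-1})+(b+b^{-1})(\lambda q+\lambda^{-1}q^{-1})$, $(a+a^{-1})(b+b^{-1})+(c+c^{-1})(\lambda q+\lambda^{-1}q^{-1})$.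 $W_\lambda^\delta(a,b,c)$ is the quotient of $M_\lambda(a,b,c)$ by the span of $\{\delta m_i-m_{d'+i}\}_{i\in\mathbb N}$, $w_i$ the image of $m_i$; barred symbols for barred parameters. $\{\pm1\}$ acts on $(\mathbb F^\times)^4$ by $(-1)\cdot(a,b,c,\lambda)=(-a,-b,-c,-\lambda)$; with $[\cdot]$ the orbit, $\mathfrak S_4$ acts on the right by $[a,b,c,\lambda](1\,2)=[a,b,c^{-1},\lambda]$, $[a,b,c,\lambda](3\,4)=[a^{-1},b,c,\lambda]$, $[a,b,c,\lambda](2\,3)=[a/s,b/s,c/s,\lambda/s]$, $s=\sqrt{abc\lambda q}$. $(a,b,c,\lambda,\delta)\simeq_{\pm,\mathfrak S_4}(\bar a,\bar b,\bar c,\bar\lambda,\bar\delta)$ means the $\{\pm1\}$-orbits of $(a,b,c,\lambda)$ and $(\bar a,\bar b,\bar c,\bar\lambda)$ lie in the same $\mathfrak S_4$-orbit and $\delta+a^{d'}\lambda^{-d'}+a^{-d'}\lambda^{d'}=\bar\delta+\bar a^{d'}\bar\lambda^{-d'}+\bar a^{-d'}\bar\lambda^{d'}$. *)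

theory Defs
  imports "HOL-Computational_Algebra.Polynomial"
begin

definition root_order :: "'a::field \<Rightarrow> nat" where
  "root_order q = (LEAST d. 0 < d \<and> q ^ d = 1)"

definition dprime :: "'a::field \<Rightarrow> nat" where
  "dprime q = (if odd (root_order q) then root_order q else root_order q div 2)"

definition theta :: "'a::field \<Rightarrow> 'a \<Rightarrow> 'a \<Rightarrow> nat \<Rightarrow> 'a" where
  "theta q a lam i = a / lam * q ^ (2 * i) + lam / a * inverse q ^ (2 * i)"

definition thetas :: "'a::field \<Rightarrow> 'a \<Rightarrow> 'a \<Rightarrow> nat \<Rightarrow> 'a" where
  "thetas q b lam i = b / lam * q ^ (2 * i) + lam / b * inverse q ^ (2 * i)"

definition phi :: "'a::field \<Rightarrow> 'a \<Rightarrow> 'a \<Rightarrow> 'a \<Rightarrow> 'a \<Rightarrow> nat \<Rightarrow> 'a" where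
  "phi q a b c lam i =
     lam * q / (a * b) * (q ^ i - inverse q ^ i)
     * (q ^ i / (lam * q) - lam * q / q ^ i)
     * (inverse q ^ i - a * b * c / lam * (q ^ i / q))
     * (inverse q ^ i - a * b / (c * lam) * (q ^ i / q))"

text \<open>Scalar by which the central element gamma acts on M_lambda(a,b,c).\<close>
definition gammaM :: "'a::field \<Rightarrow> 'a \<Rightarrow> 'a \<Rightarrow> 'a \<Rightarrow> 'a \<Rightarrow> 'a" where
  "gammaM q a b c lam =
     (a + inverse a) * (b + inverse b) + (c + inverse c) * (lam * q + inverse lam * inverse q)"

text \<open>M has basis m_0, m_1, ...; an element is its finitely supported coordinate
  function nat => F, m_i being the indicator of i.\<close>
definition FS :: "(nat \<Rightarrow> 'a::zero) set" where
  "FS = {f. finite {i. f i \<noteq> 0}}"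

definition basisv :: "nat \<Rightarrow> nat \<Rightarrow> 'a::{zero,one}" where
  "basisv i = (\<lambda>j. if j = i then 1 else 0)"

text \<open>A m_i = theta_i m_i + m_(i+1).\<close>
definition actA :: "'a::field \<Rightarrow> 'a \<Rightarrow> 'a \<Rightarrow> (nat \<Rightarrow> 'a) \<Rightarrow> (nat \<Rightarrow> 'a)" where
  "actA q a lam f = (\<lambda>j. theta q a lam j * f j + (if j = 0 then 0 else f (j - 1)))"

text \<open>B m_i = theta*_i m_i + phi_i m_(i-1)  (phi_0 = 0).\<close>
definition actB :: "'a::field \<Rightarrow> 'a \<Rightarrow> 'a \<Rightarrow> 'a \<Rightarrow> 'a \<Rightarrow> (nat \<Rightarrow> 'a) \<Rightarrow> (nat \<Rightarrow> 'a)" where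
  "actB q a b c lam f = (\<lambda>j. thetas q b lam j * f j + phi q a b c lam (Suc j) * f (Suc j))"

text \<open>C is determined by the relation: C + (qAB - q^-1 BA)/(q^2 - q^-2) is central,
  and acts on M as gamma/(q + q^-1).\<close>
definition actC :: "'a::field \<Rightarrow> 'a \<Rightarrow> 'a \<Rightarrow> 'a \<Rightarrow> 'a \<Rightarrow> (nat \<Rightarrow> 'a) \<Rightarrow> (nat \<Rightarrow> 'a)" where
  "actC q a b c lam f =
     (\<lambda>j. gammaM q a b c lam / (q + inverse q) * f j
          - (q * actA q a lam (actB q a b c lam f) j
             - inverse q * actB q a b c lam (actA q a lam f) j) / (q ^ 2 - inverse q ^ 2))"

record ('s, 'v) tqmod =
  carr :: "'v set"
  vadd :: "'v \<Rightarrow> 'v \<Rightarrow> 'v"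
  vsmul :: "'s \<Rightarrow> 'v \<Rightarrow> 'v"
  opA :: "'v \<Rightarrow> 'v"
  opB :: "'v \<Rightarrow> 'v"
  opC :: "'v \<Rightarrow> 'v"

text \<open>A Delta_q-module homomorphism: F-linear and commuting with the generators A, B, C
  (hence with all of Delta_q).\<close>
definition tq_hom :: "('s, 'v) tqmod \<Rightarrow> ('s, 'w) tqmod \<Rightarrow> ('v \<Rightarrow> 'w) \<Rightarrow> bool" where
  "tq_hom V W h \<longleftrightarrow>
     (\<forall>x\<in>carr V. h x \<in> carr W) \<and>
     (\<forall>x\<in>carr V. \<forall>y\<in>carr V. h (vadd V x y) = vadd W (h x) (h y)) \<and>
     (\<forall>s. \<forall>x\<in>carr V. h (vsmul V s x) = vsmul W s (h x)) \<and>
     (\<forall>x\<in>carr V. h (opA V x) = opA W (h x)) \<and>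
     (\<forall>x\<in>carr V. h (opB V x) = opB W (h x)) \<and>
     (\<forall>x\<in>carr V. h (opC V x) = opC W (h x))"

definition tq_iso :: "('s, 'v) tqmod \<Rightarrow> ('s, 'w) tqmod \<Rightarrow> ('v \<Rightarrow> 'w) \<Rightarrow> bool" where
  "tq_iso V W h \<longleftrightarrow> tq_hom V W h \<and> bij_betw h (carr V) (carr W)"

definition qcoset :: "(nat \<Rightarrow> 'a::field) set \<Rightarrow> (nat \<Rightarrow> 'a) \<Rightarrow> (nat \<Rightarrow> 'a) set" where
  "qcoset N f = {g \<in> FS. (\<lambda>j. f j - g j) \<in> N}"

definition qrep :: "(nat \<Rightarrow> 'a) set \<Rightarrow> (nat \<Rightarrow> 'a)" where
  "qrep X = (SOME f. f \<in> X)"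

definition quot_mod ::
  "(nat \<Rightarrow> 'a::field) set \<Rightarrow> ((nat \<Rightarrow> 'a) \<Rightarrow> (nat \<Rightarrow> 'a)) \<Rightarrow> ((nat \<Rightarrow> 'a) \<Rightarrow> (nat \<Rightarrow> 'a))
     \<Rightarrow> ((nat \<Rightarrow> 'a) \<Rightarrow> (nat \<Rightarrow> 'a)) \<Rightarrow> ('a, (nat \<Rightarrow> 'a) set) tqmod" where
  "quot_mod N fA fB fC =
     \<lparr> carr = qcoset N ` FS,
       vadd = (\<lambda>X Y. qcoset N (\<lambda>j. qrep X j + qrep Y j)),
       vsmul = (\<lambda>s X. qcoset N (\<lambda>j. s * qrep X j)),
       opA = (\<lambda>X. qcoset N (fA (qrep X))),
       opB = (\<lambda>X. qcoset N (fB (qrep X))),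
       opC = (\<lambda>X. qcoset N (fC (qrep X))) \<rparr>"

text \<open>The span of {delta m_i - m_(d'+i)}: the elements sum_i g_i (delta m_i - m_(d'+i))
  with g finitely supported.\<close>
definition Nsub :: "'a::field \<Rightarrow> 'a \<Rightarrow> (nat \<Rightarrow> 'a) set" where
  "Nsub q delta = {v. \<exists>g\<in>FS. v = (\<lambda>j. delta * g j - (if dprime q \<le> j then g (j - dprime q) else 0))}"

definition Wmod :: "'a::field \<Rightarrow> 'a \<Rightarrow> 'a \<Rightarrow> 'a \<Rightarrow> 'a \<Rightarrow> 'a \<Rightarrow> ('a, (nat \<Rightarrow> 'a) set) tqmod" where
  "Wmod q a b c lam delta =
     quot_mod (Nsub q delta) (actA q a lam) (actB q a b c lam) (actC q a b c lam)"

definition w0 :: "'a::field \<Rightarrow> 'a \<Rightarrow> (nat \<Rightarrow> 'a) set" where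
  "w0 q delta = qcoset (Nsub q delta) (basisv 0)"

text \<open>One step: the {+-1} action, or one of the generators (1 2), (3 4), (2 3) of S4 applied to a
  representative; for (2 3) any square root s of abc lambda q may be used, as the two choices
  differ by the {+-1} action.\<close>
definition s4step :: "'a::field \<Rightarrow> 'a \<times> 'a \<times> 'a \<times> 'a \<Rightarrow> 'a \<times> 'a \<times> 'a \<times> 'a \<Rightarrow> bool" where
  "s4step q t t' = (case t of (a, b, c, lam) \<Rightarrow>
      t' = (-a, -b, -c, -lam) \<or>
      t' = (a, b, inverse c, lam) \<or>
      t' = (inverse a, b, c, lam) \<or>
      (\<exists>s. s ^ 2 = a * b * c * lam * q \<and> t' = (a / s, b / s, c / s, lam / s)))"

definition pmS4_equiv :: "'a::field \<Rightarrow> 'a \<times> 'a \<times> 'a \<times> 'a \<times> 'a \<Rightarrow> 'a \<times> 'a \<times> 'a \<times> 'a \<times> 'a \<Rightarrow> bool" where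
  "pmS4_equiv q x y = (case x of (a, b, c, lam, delta) \<Rightarrow> case y of (a', b', c', lam', delta') \<Rightarrow>
      ((a, b, c, lam), (a', b', c', lam')) \<in> {(u, v). s4step q u v}\<^sup>* \<and>
      delta + (a / lam) ^ dprime q + (lam / a) ^ dprime q
        = delta' + (a' / lam') ^ dprime q + (lam' / a') ^ dprime q)"

end

theory Submission
  imports Defs
begin

text \<open>
  \<open>W\<close> is generated by \<open>w\<^sub>0\<close> under \<open>A\<close> alone, so it is \<open>F[X]/(P)\<close> with \<open>P = \<Prod>\<^sub>i (X - \<theta>\<^sub>i) - \<delta>\<close>, and a
  homomorphism matching the generators forces \<open>P\<close> and the action of \<open>B\<close> to agree.
  Putting \<open>X = y + 1/y\<close> shows that \<open>P\<close> is determined exactly by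
  \<open>\<delta> + (a/\<lambda>)\<^bsup>d'\<^esup> + (\<lambda>/a)\<^bsup>d'\<^esup>\<close>. By the Askey--Wilson relation, \<open>B\<close> is determined on \<open>F[X]\<close> by \<open>B 1\<close>,
  \<open>B X\<close> and the scalars \<open>\<beta>\<close>, \<open>\<gamma>\<close>, and \<open>B\<close> on \<open>1, X, X\<^sup>2\<close> recovers these since \<open>deg P = d' \<ge> 3\<close>.
  With \<open>\<kappa>\<^sup>2 = b/(\<lambda>q)\<close> fixed, these data are the elementary symmetric functions of the four numbers
  \<open>c\<kappa>/b\<close>, \<open>\<kappa>/(bc)\<close>, \<open>ab/\<kappa>\<close>, \<open>b/(a\<kappa>)\<close>, on which the generators of \<open>S\<^sub>4\<close> act by adjacent
  transpositions; hence they are complete invariants of the orbit.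
\<close>

section \<open>The Askey--Wilson relation\<close>

text \<open>Companion of a hypothesis \<open>x * y = 1\<close>: it cancels a unit against its
  inverse also when both stand at the head of a longer product.\<close>

lemma cancel_pair: "(x::'a::comm_ring_1) * y = 1 \<Longrightarrow> x * (y * z) = z"
  by (metis mult.assoc mult_1)

text \<open>In both identities \<open>th\<close>, \<open>ts\<close>, \<open>ph\<close> stand for \<open>\<theta>\<close>, \<open>\<theta>*\<close>, \<open>\<phi>\<close> at neighbouring indices, with
  \<open>Q = q\<^sup>2\<close>, \<open>M = \<lambda>q + 1/(\<lambda>q)\<close>, \<open>S = c + 1/c\<close>; each unit is paired with its inverse so
  that the identities are polynomial.\<close>
lemma aw_identity_lower:
  fixes S M X Y Z Q Xi Yi Zi Qi :: "'a::field"
  assumes inv: "Q * Qi = 1" "X * Xi = 1" "Y * Yi = 1" "Z * Zi = 1"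
  defines "th \<equiv> \<lambda>v vi. X * v + Xi * vi"
  defines "ts \<equiv> \<lambda>v vi. Y * v + Yi * vi"
  defines "ph \<equiv> \<lambda>v vi. (Z*v + Zi*vi-M) * (X*Y*v*Zi*Qi + Xi*Yi*vi*Z*Q-S)"
  shows "(th Q Qi + th 1 1)* ts 1 1 + ph 1 1 - (Q + Qi) * (th Q Qi * ts Q Qi + ts 1 1 * th 1 1 + ph Q Qi)
  + ts Q Qi * (th Q Qi + th 1 1) + ph (Q*Q) (Qi*Qi) + (Q+Qi-1-1)*(X*Y*Zi*Zi*Qi+X*Yi+Xi*Y+Xi*Yi*Z*Z*Q+S*M) = 0"
  unfolding th_def ts_def ph_def by (simp add: algebra_simps inv inv[THEN cancel_pair])

lemma aw_identity_diag:
  fixes S M X Y Z Q Xi Yi Zi Qi :: "'a::field"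
  assumes inv: "Q * Qi = 1" "X * Xi = 1" "Y * Yi = 1" "Z * Zi = 1"
  defines "th \<equiv> \<lambda>v vi. X * v + Xi * vi"
  defines "ts \<equiv> \<lambda>v vi. Y * v + Yi * vi"
  defines "ph \<equiv> \<lambda>v vi. (Z*v + Zi*vi-M) * (X*Y*v*Zi*Qi + Xi*Yi*vi*Z*Q-S)"
  shows "th 1 1 * th 1 1 * ts 1 1 + ts 1 1 * th 1 1 * th 1 1 + (th 1 1 + th Qi Q) * ph 1 1
     - (Q + Qi) * (th 1 1 * (ts 1 1 * th 1 1 + ph Q Qi) + ph 1 1 * th 1 1)
     + ph Q Qi * (th Q Qi + th 1 1) + (Q - Qi) * (Q - Qi) * ts 1 1
     + (Q+Qi-1-1)*(X*Y*Zi*Zi*Qi+X*Yi+Xi*Y+Xi*Yi*Z*Z*Q+S*M) * th 1 1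
     - (Q - Qi) * (S*(X*Zi*(1-Qi)+Xi*Z*(Q-1))+M*(Y*Zi*(1-Qi)+Yi*Z*(Q-1))) = 0"
  unfolding th_def ts_def ph_def by (simp add: algebra_simps inv inv[THEN cancel_pair])

text \<open>Multiplying the index-dependent factors in pairs shows that \<open>phi\<close> depends
  on \<open>i\<close> only through \<open>q^(2i)\<close>, as a product of two Laurent polynomials.
  This serves both the polynomial identities and the periodicity.\<close>

lemma phi_eq:
  assumes "q \<noteq> 0" "a \<noteq> 0" "b \<noteq> 0" "c \<noteq> 0" "lam \<noteq> 0"
  shows "phi q a b c lam i =
    ((q^i)\<^sup>2 / (lam * q) + lam * q / (q^i)\<^sup>2 - (lam * q + inverse lam * inverse q))
    * (a * b * (q^i)\<^sup>2 / (lam * q) + lam * q / (a * b * (q^i)\<^sup>2) - (c + inverse c))"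
proof -
  have "q ^ i \<noteq> 0" using assms by simp
  then show ?thesis
    unfolding phi_def power_inverse using assms
    by (simp add: field_simps power2_eq_square)
qed

lemma theta_eq: "theta q a lam i = a / lam * (q^i)\<^sup>2 + lam / a * (inverse (q^i))\<^sup>2"
  by (simp add: theta_def power_mult[symmetric] power_inverse mult.commute power_even_eq)

lemma thetas_theta: "thetas q = theta q"
  by (simp add: fun_eq_iff theta_def thetas_def)

text \<open>Raising the index by one multiplies \<open>X\<close> by \<open>Q\<close> and
  \<open>Xi\<close> by \<open>Qi\<close>, so neighbouring values of \<open>theta\<close> are linear
  in one pair of inverse units, and relations between them become polynomial identities.\<close>

lemma theta_inverse_pair:
  fixes q :: "'a::field" and i :: nat
  assumes "q \<noteq> 0" "a \<noteq> 0" "lam \<noteq> 0"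
  defines "X \<equiv> a / lam * (q^i)\<^sup>2" and "Xi \<equiv> lam / a * (inverse (q^i))\<^sup>2"
    and "Q \<equiv> q\<^sup>2" and "Qi \<equiv> (inverse q)\<^sup>2"
  shows "X * Xi = 1" "Q * Qi = 1"
    "theta q a lam i = X + Xi" "theta q a lam (Suc i) = X * Q + Xi * Qi"
    "theta q a lam (Suc (Suc i)) = X * (Q * Q) + Xi * (Qi * Qi)"
    "0 < i \<Longrightarrow> theta q a lam (i - 1) = X * Qi + Xi * Q"
proof -
  have [simp]: "q ^ i \<noteq> 0" using assms by simp
  show "X * Xi = 1" "Q * Qi = 1"
    using assms by (simp_all add: field_simps)
  show "theta q a lam i = X + Xi" "theta q a lam (Suc i) = X * Q + Xi * Qi"
    "theta q a lam (Suc (Suc i)) = X * (Q * Q) + Xi * (Qi * Qi)"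
    by (simp_all add: theta_eq assms power2_eq_square mult_ac)
  show "theta q a lam (i - 1) = X * Qi + Xi * Q" if "0 < i"
    using that assms(1) by (cases i) (simp_all add: theta_eq assms field_simps power2_eq_square)
qed

text \<open>Both \<open>q^(2i)\<close> and \<open>q^(-2i)\<close> solve the recurrence with
  characteristic roots \<open>q^2\<close> and \<open>q^(-2)\<close>. For \<open>thetas\<close> this
  is the Askey--Wilson entry in row \<open>i + 2\<close> and column \<open>i\<close>.\<close>

lemma theta_second_difference:
  fixes q :: "'a::field"
  assumes "q \<noteq> 0" "a \<noteq> 0" "lam \<noteq> 0"
  shows "theta q a lam i - (q\<^sup>2 + (inverse q)\<^sup>2) * theta q a lam (Suc i) + theta q a lam (Suc (Suc i)) = 0"
proof -
  have "X + Xi - (Q + Qi) * (X * Q + Xi * Qi) + (X * (Q * Q) + Xi * (Qi * Qi)) = 0"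
    if "Q * Qi = 1" for X Xi Q Qi :: 'a
    using that by (simp add: algebra_simps cancel_pair)
  from this[OF theta_inverse_pair(2)[OF assms]] show ?thesis
    unfolding theta_inverse_pair(3-5)[OF assms, where i = i] by blast
qed

text \<open>Times \<open>phi\<close> at \<open>i + 1\<close>, this is the Askey--Wilson entry in row
  \<open>i\<close> and column \<open>i + 1\<close>.\<close>

lemma theta_quadratic:
  fixes q :: "'a::field" and i :: nat
  assumes "q \<noteq> 0" "a \<noteq> 0" "lam \<noteq> 0"
  defines "th \<equiv> theta q a lam"
  shows "th i * th i - (q\<^sup>2 + (inverse q)\<^sup>2) * (th i * th (Suc i)) + th (Suc i) * th (Suc i)
    + (q\<^sup>2 - (inverse q)\<^sup>2)\<^sup>2 = 0"
proof -
  have "(X + Xi) * (X + Xi) - (Q + Qi) * ((X + Xi) * (X * Q + Xi * Qi))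
      + (X * Q + Xi * Qi) * (X * Q + Xi * Qi) + (Q - Qi)\<^sup>2 = 0"
    if "X * Xi = 1" "Q * Qi = 1" for X Xi Q Qi :: 'a
    unfolding power2_eq_square using that by (simp add: algebra_simps cancel_pair)
  from this[OF theta_inverse_pair(1,2)[OF assms(1-3)]] show ?thesis
    unfolding th_def theta_inverse_pair(3-5)[OF assms(1-3), where i = i] by blast
qed

context
  fixes q a b c lam :: "'a::field"
  assumes nz: "q \<noteq> 0" "a \<noteq> 0" "b \<noteq> 0" "c \<noteq> 0" "lam \<noteq> 0"
begin

text \<open>A raises the index by at most one and B lowers it by at most one, so the Askey--Wilson
  matrix has four diagonals. These are the entries in row \<open>i + 1\<close>, column
  \<open>i\<close>, and on the main diagonal; the other two come from
  \<open>theta_second_difference\<close> and \<open>theta_quadratic\<close>.\<close>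

lemma aw_coefficients:
  fixes i :: nat
  defines "k \<equiv> q\<^sup>2 + (inverse q)\<^sup>2" and "th \<equiv> theta q a lam" and "ts \<equiv> thetas q b lam"
    and "ph \<equiv> phi q a b c lam"
  shows "(th (Suc i) + th i) * ts i + ph i
      - k * (th (Suc i) * ts (Suc i) + ts i * th i + ph (Suc i))
      + ts (Suc i) * (th (Suc i) + th i) + ph (Suc (Suc i))
      + (q - inverse q)\<^sup>2 * gammaM q a b c lam = 0"
   and "th i * th i * ts i + ts i * th i * th i
     + (if i = 0 then 0 else (th i + th (i - 1)) * ph i)
     - k * (th i * (ts i * th i + ph (Suc i)) + ph i * th i)
     + ph (Suc i) * (th (Suc i) + th i) + (q\<^sup>2 - (inverse q)\<^sup>2)\<^sup>2 * ts i
     + (q - inverse q)\<^sup>2 * gammaM q a b c lam * th i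
     - (q\<^sup>2 - (inverse q)\<^sup>2) * (q - inverse q) * gammaM q c a b lam = 0"
proof -
  define X Xi where "X = a / lam * (q^i)\<^sup>2" and "Xi = lam / a * (inverse (q^i))\<^sup>2"
  define Y Yi where "Y = b / lam * (q^i)\<^sup>2" and "Yi = lam / b * (inverse (q^i))\<^sup>2"
  define Q Qi where "Q = q\<^sup>2" and "Qi = (inverse q)\<^sup>2"
  define Z Zi where "Z = (q^i)\<^sup>2 / (lam * q)" and "Zi = lam * q / (q^i)\<^sup>2"
  define M S where "M = lam * q + inverse lam * inverse q" and "S = c + inverse c"
  have [simp]: "q ^ i \<noteq> 0" using nz by simp
  have inv: "Q * Qi = 1" "X * Xi = 1" "Y * Yi = 1" "Z * Zi = 1"
    using nz by (simp_all add: Q_def Qi_def X_def Xi_def Y_def Yi_def Z_def Zi_def field_simps)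
  note T = theta_inverse_pair(3-6)[OF nz(1,2,5), of i, folded th_def X_def Xi_def Q_def Qi_def]
  note Ts = theta_inverse_pair(3-5)[OF nz(1,3,5), of i, folded thetas_theta, folded ts_def Y_def Yi_def Q_def Qi_def]
  have P: "ph i = (Z + Zi - M) * (X * Y * Zi * Qi + Xi * Yi * Z * Q - S)"
     "ph (Suc i) = (Z * Q + Zi * Qi - M) * (X * Y * Q * Zi * Qi + Xi * Yi * Qi * Z * Q - S)"
     "ph (Suc (Suc i)) = (Z * (Q * Q) + Zi * (Qi * Qi) - M)
        * (X * Y * (Q * Q) * Zi * Qi + Xi * Yi * (Qi * Qi) * Z * Q - S)"
    unfolding ph_def phi_eq[OF nz] M_def[symmetric] S_def[symmetric]
    by (rule arg_cong2[of _ _ _ _ "(*)"];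
        use nz in \<open>simp add: X_def Xi_def Y_def Yi_def Z_def Zi_def Q_def Qi_def field_simps power2_eq_square\<close>)+
  have D: "(q - inverse q)\<^sup>2 = Q + Qi - 1 - 1"
    using nz by (simp add: Q_def Qi_def power2_eq_square algebra_simps)
  have G: "gammaM q a b c lam = X*Y*Zi*Zi*Qi+X*Yi+Xi*Y+Xi*Yi*Z*Z*Q+S*M"
    unfolding gammaM_def M_def[symmetric] S_def[symmetric]
    using nz by (simp add: X_def Xi_def Y_def Yi_def Z_def Zi_def Q_def Qi_def field_simps power2_eq_square)
  have B: "(q - inverse q) * gammaM q c a b lam
      = S*(X*Zi*(1-Qi)+Xi*Z*(Q-1))+M*(Y*Zi*(1-Qi)+Yi*Z*(Q-1))"
  proof -
    have "(q - inverse q) * (a + inverse a) = X*Zi*(1-Qi)+Xi*Z*(Q-1)"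
      "(q - inverse q) * (b + inverse b) = Y*Zi*(1-Qi)+Yi*Z*(Q-1)"
      using nz by (simp_all add: X_def Xi_def Y_def Yi_def Z_def Zi_def Q_def Qi_def field_simps power2_eq_square)
    then show ?thesis
      unfolding gammaM_def M_def[symmetric] S_def[symmetric] by algebra
  qed
  show "(th (Suc i) + th i) * ts i + ph i
      - k * (th (Suc i) * ts (Suc i) + ts i * th i + ph (Suc i))
      + ts (Suc i) * (th (Suc i) + th i) + ph (Suc (Suc i))
      + (q - inverse q)\<^sup>2 * gammaM q a b c lam = 0"
    using aw_identity_lower[OF inv, of M S]
    unfolding T(1-3) Ts P D G k_def Q_def[symmetric] Qi_def[symmetric] by simp
  have "th i * th i * ts i + ts i * th i * th i + (th i + (X * Qi + Xi * Q)) * ph i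
     - (Q + Qi) * (th i * (ts i * th i + ph (Suc i)) + ph i * th i)
     + ph (Suc i) * (th (Suc i) + th i) + (Q - Qi) * (Q - Qi) * ts i
     + (q - inverse q)\<^sup>2 * gammaM q a b c lam * th i
     - (Q - Qi) * ((q - inverse q) * gammaM q c a b lam) = 0"
    using aw_identity_diag[OF inv, of M S] unfolding T(1-3) Ts P D G B by simp
  \<comment> \<open>At \<open>i = 0\<close> there is no predecessor index, but \<open>phi\<close>
    vanishes there and removes the term.\<close>
  moreover have "(th i + (X * Qi + Xi * Q)) * ph i = (if i = 0 then 0 else (th i + th (i - 1)) * ph i)"
    using T(4) by (cases "i = 0") (simp_all add: ph_def phi_def)
  ultimately show "th i * th i * ts i + ts i * th i * th i
     + (if i = 0 then 0 else (th i + th (i - 1)) * ph i)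
     - k * (th i * (ts i * th i + ph (Suc i)) + ph i * th i)
     + ph (Suc i) * (th (Suc i) + th i) + (q\<^sup>2 - (inverse q)\<^sup>2)\<^sup>2 * ts i
     + (q - inverse q)\<^sup>2 * gammaM q a b c lam * th i
     - (q\<^sup>2 - (inverse q)\<^sup>2) * (q - inverse q) * gammaM q c a b lam = 0"
    unfolding k_def Q_def[symmetric] Qi_def[symmetric]
    by (simp only: power2_eq_square[of "Q - Qi"] mult.assoc[of "Q - Qi" "q - inverse q"])
qed

text \<open>This is the relation for \<beta> with C eliminated by means of the one for \<gamma>;
  \<open>gammaM q c a b lam\<close> is \<beta>. It is verified entry by entry.\<close>

lemma askey_wilson:
  fixes f :: "nat \<Rightarrow> 'a"
  defines "fA \<equiv> actA q a lam" and "fB \<equiv> actB q a b c lam"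
  shows "fA (fA (fB f)) j - (q\<^sup>2 + (inverse q)\<^sup>2) * fA (fB (fA f)) j + fB (fA (fA f)) j
    + (q\<^sup>2 - (inverse q)\<^sup>2)\<^sup>2 * fB f j + (q - inverse q)\<^sup>2 * gammaM q a b c lam * fA f j
    - (q\<^sup>2 - (inverse q)\<^sup>2) * (q - inverse q) * gammaM q c a b lam * f j = 0" (is "?L = 0")
proof -
  define k where "k = q\<^sup>2 + (inverse q)\<^sup>2"
  define g where "g = (q - inverse q)\<^sup>2 * gammaM q a b c lam"
  define e where "e = (q\<^sup>2 - (inverse q)\<^sup>2) * (q - inverse q) * gammaM q c a b lam"
  define D where "D = (q\<^sup>2 - (inverse q)\<^sup>2)\<^sup>2"
  define th ts ph where "th = theta q a lam" and "ts = thetas q b lam" and "ph = phi q a b c lam"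
  note quad = theta_quadratic[OF nz(1,2,5), folded th_def k_def D_def]
  note lin = theta_second_difference[OF nz(1,3,5), folded thetas_theta, folded k_def ts_def]
  note cf = aw_coefficients[folded th_def ts_def ph_def k_def, folded g_def e_def D_def]
  note defs = fA_def fB_def actA_def actB_def th_def[symmetric] ts_def[symmetric] ph_def[symmetric]
    k_def[symmetric] g_def[symmetric] e_def[symmetric] D_def[symmetric]
  have ph0: "ph 0 = 0" by (simp add: ph_def phi_def)
  \<comment> \<open>Rows 0 and 1 have no column \<open>j - 2\<close>, and row 0 has no column
    \<open>j - 1\<close>, so these entries are absent there.\<close>
  consider "j = 0" | "j = Suc 0" | i where "j = Suc (Suc i)" by (metis not0_implies_Suc)
  then show ?thesis
  proof cases
    case 1
    show ?thesis
      using quad[of 0] cf(2)[of 0] ph0 unfolding defs 1 by simp algebra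
  next
    case 2
    show ?thesis
      using quad[of 1] cf(2)[of 1] cf(1)[of 0] ph0 unfolding defs 2 by simp algebra
  next
    case (3 i)
    show ?thesis
      using quad[of j] cf(2)[of j] cf(1)[of "Suc i"] lin[of i] unfolding defs 3 by simp algebra
  qed
qed

end

section \<open>Invariants of the orbits\<close>

lemma swap_closed_elementary_symmetric2:
  fixes x1 x2 y1 y2 :: "'a::idom"
  assumes "Q x1 x2" and swap: "\<And>u v. Q u v \<Longrightarrow> Q v u"
    and "x1 + x2 = y1 + y2" "x1 * x2 = y1 * y2"
  shows "Q y1 y2"
proof -
  have "(y1 - x1) * (y1 - x2) = 0" using assms(3,4) by algebra
  then consider "y1 = x1" | "y1 = x2" by auto
  then show ?thesis
  proof cases
    case 1
    then have "y2 = x2" using assms(3) by simp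
    then show ?thesis using assms(1) 1 by simp
  next
    case 2
    then have "y2 = x1" using assms(3) by (simp add: add.commute)
    then show ?thesis using swap[OF assms(1)] 2 by simp
  qed
qed

text \<open>Equal symmetric functions make \<open>y1\<close> a root of the cubic with roots
  \<open>x1\<close>, \<open>x2\<close>, \<open>x3\<close>. Adjacent swaps bring that root to the
  front, and the other two arguments are compared as a pair.\<close>

lemma swap_closed_elementary_symmetric3:
  fixes x1 x2 x3 y1 y2 y3 :: "'a::idom"
  assumes Q: "Q x1 x2 x3"
    and swap: "\<And>u v w. Q u v w \<Longrightarrow> Q v u w" "\<And>u v w. Q u v w \<Longrightarrow> Q u w v"
    and e: "x1 + x2 + x3 = y1 + y2 + y3"
      "x1 * x2 + x1 * x3 + x2 * x3 = y1 * y2 + y1 * y3 + y2 * y3"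
      "x1 * x2 * x3 = y1 * y2 * y3"
  shows "Q y1 y2 y3"
proof -
  have *: "Q y1 y2 y3" if "Q y1 u v" "y1 + u + v = y1 + y2 + y3"
    "y1 * u + y1 * v + u * v = y1 * y2 + y1 * y3 + y2 * y3" for u v
  proof -
    have "u + v = y2 + y3" "u * v = y2 * y3" using that(2,3) by algebra+
    with that(1) show ?thesis
      using swap_closed_elementary_symmetric2[of "Q y1", OF that(1) swap(2)] by blast
  qed
  have "(y1 - x1) * (y1 - x2) * (y1 - x3) = 0" using e by algebra
  then consider "y1 = x1" | "y1 = x2" | "y1 = x3" by auto
  then show ?thesis
  proof cases
    case 1
    show ?thesis using *[of x2 x3] Q e 1 by simp
  next
    case 2
    show ?thesis using *[of x1 x3] swap(1)[OF Q] e 2 by (simp add: algebra_simps)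
  next
    case 3
    show ?thesis using *[of x1 x2] swap(1)[OF swap(2)[OF Q]] e 3 by (simp add: algebra_simps)
  qed
qed

text \<open>With \<open>Q\<close> taken as reachability by steps, this turns equal invariants into a
  chain of steps. The proof again splits off the root \<open>y1\<close>.\<close>

lemma swap_closed_elementary_symmetric4:
  fixes x1 x2 x3 x4 y1 y2 y3 y4 :: "'a::idom"
  assumes Q: "Q x1 x2 x3 x4"
    and swap: "\<And>u v w z. Q u v w z \<Longrightarrow> Q v u w z" "\<And>u v w z. Q u v w z \<Longrightarrow> Q u w v z"
      "\<And>u v w z. Q u v w z \<Longrightarrow> Q u v z w"
    and e: "x1 + x2 + x3 + x4 = y1 + y2 + y3 + y4"
      "(x1 + x2) * (x3 + x4) + x1 * x2 + x3 * x4 = (y1 + y2) * (y3 + y4) + y1 * y2 + y3 * y4"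
      "x1 * x2 * (x3 + x4) + (x1 + x2) * x3 * x4 = y1 * y2 * (y3 + y4) + (y1 + y2) * y3 * y4"
      "x1 * x2 * x3 * x4 = y1 * y2 * y3 * y4"
  shows "Q y1 y2 y3 y4"
proof -
  \<comment> \<open>With the common entry \<open>y1\<close> in front, its contribution is removed
    successively from the symmetric functions, leaving those of the remaining three.\<close>
  have *: "Q y1 y2 y3 y4" if "Q y1 u v w" "y1 + u + v + w = y1 + y2 + y3 + y4"
    "(y1 + u) * (v + w) + y1 * u + v * w = (y1 + y2) * (y3 + y4) + y1 * y2 + y3 * y4"
    "y1 * u * (v + w) + (y1 + u) * v * w = y1 * y2 * (y3 + y4) + (y1 + y2) * y3 * y4" for u v w
  proof -
    have "u + v + w = y2 + y3 + y4" using that(2) by algebra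
    moreover from this have "u * v + u * w + v * w = y2 * y3 + y2 * y4 + y3 * y4"
      using that(3) by algebra
    moreover from this have "u * v * w = y2 * y3 * y4" using that(4) by algebra
    ultimately show ?thesis
      using swap_closed_elementary_symmetric3[of "Q y1", OF that(1) swap(2,3)] by blast
  qed
  have "(y1 - x1) * (y1 - x2) * (y1 - x3) * (y1 - x4) = 0" using e by algebra
  then consider "y1 = x1" | "y1 = x2" | "y1 = x3" | "y1 = x4" by auto
  then show ?thesis
  proof cases
    case 1
    show ?thesis using *[of x2 x3 x4] Q e 1 by simp
  next
    case 2
    show ?thesis using *[of x1 x3 x4] swap(1)[OF Q] e 2 by (simp add: algebra_simps)
  next
    case 3
    show ?thesis using *[of x1 x2 x4] swap(1)[OF swap(2)[OF Q]] e 3 by (simp add: algebra_simps)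
  next
    case 4
    show ?thesis using *[of x1 x2 x3] swap(1)[OF swap(2)[OF swap(3)[OF Q]]] e 4
      by (simp add: algebra_simps)
  qed
qed

text \<open>Up to the factor \<open>q - q\<inverse>\<close> this is the constant term of \<open>B A m\<^sub>0\<close> as a polynomial in \<open>A\<close>
  (\<open>phi_1_iotaM\<close> below).\<close>
definition iotaM :: "'a::field \<Rightarrow> 'a \<Rightarrow> 'a \<Rightarrow> 'a \<Rightarrow> 'a \<Rightarrow> 'a" where
  "iotaM q a b c lam =
    (a + inverse a) * (inverse (b * q) - b * q) - (c + inverse c) * (inverse lam - lam)"

text \<open>The data that determine B on F[X]: \<open>b / lam\<close> gives the leading coefficients
  of B on 1 and X, \<open>iotaM\<close> the constant term of B on X, and the last two entries are
  the scalars \<gamma> and \<beta>.\<close>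

definition verma_invariants :: "'a::field \<Rightarrow> 'a \<times> 'a \<times> 'a \<times> 'a \<Rightarrow> 'a \<times> 'a \<times> 'a \<times> 'a" where
  "verma_invariants q x = (case x of (a, b, c, lam) \<Rightarrow>
     (b / lam, iotaM q a b c lam, gammaM q a b c lam, gammaM q c a b lam))"

text \<open>For fixed \<open>\<kappa>\<close> with \<open>\<kappa>\<^sup>2 = b / (\<lambda> q)\<close> the steps (1 2), (2 3), (3 4) act on the
  following four coordinates, whose product is 1, by adjacent transpositions.\<close>
definition s4coords :: "'a::field \<Rightarrow> 'a \<times> 'a \<times> 'a \<times> 'a \<Rightarrow> 'a \<times> 'a \<times> 'a \<times> 'a" where
  "s4coords \<kappa> x = (case x of (a, b, c, lam) \<Rightarrow>
     (c * \<kappa> / b, \<kappa> / (c * b), a * b / \<kappa>, b / (a * \<kappa>)))"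

text \<open>Every step preserves \<open>b / lam\<close>, so a single \<kappa> serves a whole
  orbit.\<close>

definition admissible :: "'a::field \<Rightarrow> 'a \<Rightarrow> 'a \<times> 'a \<times> 'a \<times> 'a \<Rightarrow> bool" where
  "admissible q \<kappa> x = (case x of (a, b, c, lam) \<Rightarrow>
     a \<noteq> 0 \<and> b \<noteq> 0 \<and> c \<noteq> 0 \<and> lam \<noteq> 0 \<and> \<kappa>\<^sup>2 * q = b / lam)"

text \<open>With \<open>l = b / \<kappa>\<close> the coordinates are \<open>c / l\<close>,
  \<open>1 / (c l)\<close>, \<open>a l\<close>, \<open>l / a\<close>, and
  \<open>lam = l / (\<kappa> q)\<close>. In these terms the symmetric functions expand to the
  ingredients of the invariants.\<close>

lemma verma_invariants_s4coords:
  fixes q \<kappa> :: "'a::field"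
  assumes "q \<noteq> 0" "admissible q \<kappa> x" "s4coords \<kappa> x = (y1, y2, y3, y4)"
  defines "e1 \<equiv> y1 + y2 + y3 + y4"
    and "e2 \<equiv> (y1 + y2) * (y3 + y4) + y1 * y2 + y3 * y4"
    and "e3 \<equiv> y1 * y2 * (y3 + y4) + (y1 + y2) * y3 * y4"
  shows "y1 * y2 * y3 * y4 = 1" "\<kappa> \<noteq> 0"
    "verma_invariants q x =
      (\<kappa>\<^sup>2 * q, e3 / (\<kappa> * q) - \<kappa> * q * e1, \<kappa> * e1 + e3 / \<kappa>, e2 + \<kappa>\<^sup>2 + 1 / \<kappa>\<^sup>2)"
proof -
  obtain a b c lam where x: "x = (a, b, c, lam)" by (cases x)
  have nz: "a \<noteq> 0" "b \<noteq> 0" "c \<noteq> 0" "lam \<noteq> 0" and k: "\<kappa>\<^sup>2 * q = b / lam"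
    using assms(2) by (simp_all add: admissible_def x)
  show \<kappa>: "\<kappa> \<noteq> 0" using k nz by auto
  have y: "y1 = c * \<kappa> / b" "y2 = \<kappa> / (c * b)" "y3 = a * b / \<kappa>" "y4 = b / (a * \<kappa>)"
    using assms(3) by (simp_all add: s4coords_def x)
  show "y1 * y2 * y3 * y4 = 1"
    using nz \<kappa> by (simp add: y)
  have lam: "lam = b / (\<kappa>\<^sup>2 * q)" using k nz \<kappa> assms(1) by (simp add: field_simps)
  define l li ki qi where "l = b / \<kappa>" and "li = \<kappa> / b" and "ki = inverse \<kappa>" and "qi = inverse q"
  define ai ci where "ai = inverse a" and "ci = inverse c"
  have inv: "a * ai = 1" "c * ci = 1" "\<kappa> * ki = 1" "l * li = 1" "q * qi = 1"
    using nz \<kappa> assms(1) by (simp_all add: l_def li_def ki_def qi_def ai_def ci_def)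
  note inv = inv inv[THEN cancel_pair]
  have b: "b = \<kappa> * l" "inverse (\<kappa> * l * q) = ki * li * qi" "inverse (\<kappa> * l) = ki * li"
    and lam': "lam = l * ki * qi" "inverse (l * ki * qi) = li * \<kappa> * q"
    using nz \<kappa> assms(1)
    by (simp_all add: lam l_def li_def ki_def qi_def power2_eq_square field_simps)
  have y': "y1 = c * li" "y2 = ci * li" "y3 = a * l" "y4 = ai * l"
    using nz \<kappa> by (simp_all add: y l_def li_def ai_def ci_def field_simps)
  have e: "e1 = (c + ci) * li + (a + ai) * l" "e3 = (c + ci) * l + (a + ai) * li"
    "e2 = (c + ci) * (a + ai) + li * li + l * l"
    unfolding e1_def e2_def e3_def y' by (simp_all add: algebra_simps inv)
  have d: "z / (\<kappa> * q) = z * ki * qi" "z / \<kappa> = z * ki" "1 / \<kappa>\<^sup>2 = ki * ki" for z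
    by (simp_all add: ki_def qi_def divide_inverse power2_eq_square)
  have "b / lam = \<kappa>\<^sup>2 * q" using k by simp
  moreover have "iotaM q a b c lam = e3 / (\<kappa> * q) - \<kappa> * q * e1"
    unfolding iotaM_def e d b lam' ai_def[symmetric] ci_def[symmetric] by (simp add: algebra_simps inv)
  moreover have "gammaM q a b c lam = \<kappa> * e1 + e3 / \<kappa>"
    unfolding gammaM_def e d b lam' ai_def[symmetric] ci_def[symmetric] qi_def[symmetric]
    by (simp add: algebra_simps inv)
  moreover have "gammaM q c a b lam = e2 + \<kappa>\<^sup>2 + 1 / \<kappa>\<^sup>2"
    unfolding gammaM_def e d b lam' ai_def[symmetric] ci_def[symmetric] qi_def[symmetric]
    by (simp add: algebra_simps inv power2_eq_square)
  ultimately show "verma_invariants q x =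
      (\<kappa>\<^sup>2 * q, e3 / (\<kappa> * q) - \<kappa> * q * e1, \<kappa> * e1 + e3 / \<kappa>, e2 + \<kappa>\<^sup>2 + 1 / \<kappa>\<^sup>2)"
    by (simp add: verma_invariants_def x)
qed

lemma s4coords_neg:
  assumes "admissible q \<kappa> (a, b, c, lam)"
  shows "admissible q \<kappa> (-a, -b, -c, -lam)"
    "s4coords \<kappa> (-a, -b, -c, -lam) = s4coords \<kappa> (a, b, c, lam)"
  using assms by (simp_all add: s4coords_def admissible_def)

lemma s4coords_swaps:
  assumes "q \<noteq> 0" "admissible q \<kappa> (a, b, c, lam)" "s4coords \<kappa> (a, b, c, lam) = (y1, y2, y3, y4)"
  shows "admissible q \<kappa> (a, b, inverse c, lam)"
    "s4coords \<kappa> (a, b, inverse c, lam) = (y2, y1, y3, y4)"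
    "admissible q \<kappa> (inverse a, b, c, lam)"
    "s4coords \<kappa> (inverse a, b, c, lam) = (y1, y2, y4, y3)"
    "s\<^sup>2 = a * b * c * lam * q \<Longrightarrow> admissible q \<kappa> (a / s, b / s, c / s, lam / s)"
    "s\<^sup>2 = a * b * c * lam * q \<Longrightarrow> s4coords \<kappa> (a / s, b / s, c / s, lam / s) = (y1, y3, y2, y4)"
proof -
  have nz: "a \<noteq> 0" "b \<noteq> 0" "c \<noteq> 0" "lam \<noteq> 0" and k: "\<kappa>\<^sup>2 * q = b / lam"
    using assms(2) by (simp_all add: admissible_def)
  have \<kappa>: "\<kappa> \<noteq> 0" using k nz by auto
  have lam: "lam = b / (\<kappa>\<^sup>2 * q)" using k nz \<kappa> assms(1) by (simp add: field_simps)
  show "admissible q \<kappa> (a, b, inverse c, lam)" "admissible q \<kappa> (inverse a, b, c, lam)"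
    using nz k by (simp_all add: admissible_def)
  have y: "y1 = c * \<kappa> / b" "y2 = \<kappa> / (c * b)" "y3 = a * b / \<kappa>" "y4 = b / (a * \<kappa>)"
    using assms(3) by (simp_all add: s4coords_def)
  show "s4coords \<kappa> (a, b, inverse c, lam) = (y2, y1, y3, y4)"
    "s4coords \<kappa> (inverse a, b, c, lam) = (y1, y2, y4, y3)"
    by (simp_all add: s4coords_def y divide_inverse mult_ac)
  assume s: "s\<^sup>2 = a * b * c * lam * q"
  have s0: "s \<noteq> 0" using s nz assms(1) by auto
  then show "admissible q \<kappa> (a / s, b / s, c / s, lam / s)"
    using nz k by (simp add: admissible_def)
  \<comment> \<open>In the first and last coordinates \<open>s\<close> cancels; in the two middle
    ones only \<open>s^2\<close> occurs, and this value of it interchanges them.\<close>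
  have s2: "s * s = a * b * c * b / (\<kappa> * \<kappa>)"
    using s assms(1) by (simp add: lam power2_eq_square)
  have "\<kappa> / (c / s * (b / s)) = \<kappa> * (s * s) / (c * b)" by simp
  then have "\<kappa> / (c / s * (b / s)) = y3" using nz \<kappa> by (simp add: s2 y)
  moreover have "(a / s) * (b / s) / \<kappa> = a * b / ((s * s) * \<kappa>)" by simp
  then have "(a / s) * (b / s) / \<kappa> = y2" using nz \<kappa> by (simp add: s2 y)
  moreover have "c / s * \<kappa> / (b / s) = y1" "b / s / (a / s * \<kappa>) = y4"
    using s0 by (simp_all add: y)
  ultimately show "s4coords \<kappa> (a / s, b / s, c / s, lam / s) = (y1, y3, y2, y4)"
    by (simp only: s4coords_def prod.case)
qed

lemma s4step_verma_invariants:
  assumes "q \<noteq> 0" "admissible q \<kappa> x" "s4step q x x'"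
  shows "admissible q \<kappa> x'" "verma_invariants q x' = verma_invariants q x"
proof -
  obtain a b c lam where x: "x = (a, b, c, lam)" by (cases x)
  obtain y1 y2 y3 y4 where y: "s4coords \<kappa> x = (y1, y2, y3, y4)" by (cases "s4coords \<kappa> x")
  note sw = s4coords_swaps[OF assms(1) assms(2)[unfolded x] y[unfolded x]]
    s4coords_neg[OF assms(2)[unfolded x]]
  obtain z1 z2 z3 z4 where adm: "admissible q \<kappa> x'" and z: "s4coords \<kappa> x' = (z1, z2, z3, z4)"
    and "z1 + z2 + z3 + z4 = y1 + y2 + y3 + y4"
    "(z1 + z2) * (z3 + z4) + z1 * z2 + z3 * z4 = (y1 + y2) * (y3 + y4) + y1 * y2 + y3 * y4"
    "z1 * z2 * (z3 + z4) + (z1 + z2) * z3 * z4 = y1 * y2 * (y3 + y4) + (y1 + y2) * y3 * y4"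
  proof -
    consider "x' = (-a, -b, -c, -lam)" | "x' = (a, b, inverse c, lam)" | "x' = (inverse a, b, c, lam)"
      | s where "s\<^sup>2 = a * b * c * lam * q" "x' = (a / s, b / s, c / s, lam / s)"
      using assms(3) unfolding s4step_def x prod.case by blast
    then show thesis
    proof cases
      case 1
      show thesis by (rule that[of y1 y2 y3 y4]) (use sw(7,8) y in \<open>simp_all add: 1 x\<close>)
    next
      case 2
      show thesis
        by (rule that[of y2 y1 y3 y4]) (unfold 2, rule sw, rule sw, simp_all add: algebra_simps)
    next
      case 3
      show thesis
        by (rule that[of y1 y2 y4 y3]) (unfold 3, rule sw, rule sw, simp_all add: algebra_simps)
    next
      case 4
      show thesis
        by (rule that[of y1 y3 y2 y4])
          (unfold 4(2), rule sw, rule 4, rule sw, rule 4, simp_all add: algebra_simps)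
    qed
  qed
  then show "verma_invariants q x' = verma_invariants q x"
    unfolding verma_invariants_s4coords(3)[OF assms(1) adm z]
      verma_invariants_s4coords(3)[OF assms(1,2) y] by (simp only:)
  show "admissible q \<kappa> x'" by (rule adm)
qed

lemma s4steps_verma_invariants:
  assumes "(x, x') \<in> {(u, v). s4step q u v}\<^sup>*" "q \<noteq> 0" "admissible q \<kappa> x"
  shows "admissible q \<kappa> x' \<and> verma_invariants q x' = verma_invariants q x"
  using assms(1)
proof (induction rule: rtrancl_induct)
  case base
  show ?case using assms(3) by simp
next
  case (step y z)
  then show ?case
    using s4step_verma_invariants[OF assms(2), of \<kappa> y z] by simp
qed

text \<open>The product of the last two coordinates is \<open>(b / \<kappa>)^2\<close>, which fixes
  \<open>b\<close> up to sign; the sign then determines \<open>a\<close>, \<open>c\<close> and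
  \<open>lam\<close>. So the coordinates forget only the action of -1.\<close>

lemma s4coords_eq_imp:
  fixes q :: "'a::field"
  assumes "q \<noteq> 0" "admissible q \<kappa> x" "admissible q \<kappa> x'" "s4coords \<kappa> x = s4coords \<kappa> x'"
  shows "x' = x \<or> s4step q x x'"
proof -
  obtain a b c lam where x: "x = (a, b, c, lam)" by (cases x)
  obtain a' b' c' lam' where x': "x' = (a', b', c', lam')" by (cases x')
  have nz: "a \<noteq> 0" "b \<noteq> 0" "c \<noteq> 0" "lam \<noteq> 0" and k: "\<kappa>\<^sup>2 * q = b / lam"
    using assms(2) by (simp_all add: admissible_def x)
  have nz': "a' \<noteq> 0" "b' \<noteq> 0" "c' \<noteq> 0" "lam' \<noteq> 0" and k': "\<kappa>\<^sup>2 * q = b' / lam'"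
    using assms(3) by (simp_all add: admissible_def x')
  have \<kappa>: "\<kappa> \<noteq> 0" using k nz by auto
  have eq: "c * \<kappa> / b = c' * \<kappa> / b'" "a * b / \<kappa> = a' * b' / \<kappa>" "b / (a * \<kappa>) = b' / (a' * \<kappa>)"
    using assms(4) by (simp_all add: s4coords_def x x')
  have ab: "a * b = a' * b'" "b * a' = b' * a"
    using eq(2,3) \<kappa> nz nz' by (simp_all add: frac_eq_eq)
  have "(a * b) * (b * a') = (a' * b') * (b' * a)" by (simp only: ab)
  then have "(a * a') * (b * b) = (a * a') * (b' * b')" by (simp only: ac_simps)
  then have "b' * b' = b * b" using nz nz' by simp
  then consider "b' = b" | "b' = - b" by (auto simp: square_eq_iff)
  moreover have c: "c * b' = c' * b" using eq(1) \<kappa> nz nz' by (simp add: frac_eq_eq)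
  moreover have l: "b * lam' = b' * lam" using k k' nz nz' by (simp add: frac_eq_eq)
  ultimately show ?thesis
  proof cases
    case 1
    then have "a' = a" "c' = c" "lam' = lam" using ab(2) c l nz by simp_all
    then show ?thesis using 1 by (simp add: x x')
  next
    case 2
    then have "b * (a' + a) = 0" "b * (c' + c) = 0" "b * (lam' + lam) = 0" using ab(2) c l by algebra+
    then have "a' = - a" "c' = - c" "lam' = - lam"
      using nz by (simp_all add: eq_neg_iff_add_eq_0)
    then show ?thesis using 2 by (simp add: x x' s4step_def)
  qed
qed

lemma alg_closed_sqrt:
  fixes z :: "'a::field"
  assumes "\<forall>p::'a poly. 0 < degree p \<longrightarrow> (\<exists>x. poly p x = 0)"
  obtains s where "s\<^sup>2 = z"
proof -
  obtain s where "poly [:-z, 0, 1:] s = 0"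
    using assms[rule_format, of "[:-z, 0, 1:]"] by auto
  then have "s\<^sup>2 = z" by (simp add: power2_eq_square)
  then show thesis by (rule that)
qed

text \<open>Forwards, each step preserves the invariants. Backwards, the invariants give the
  symmetric functions of the coordinates, hence a permutation of them, which steps realise. The
  square roots, for \<kappa> and for (2 3), come from algebraic closedness.\<close>

lemma s4steps_iff_verma_invariants:
  fixes q :: "'a::field"
  assumes alg_closed: "\<forall>p::'a poly. 0 < degree p \<longrightarrow> (\<exists>x. poly p x = 0)"
    and q: "q \<noteq> 0" "q\<^sup>2 + 1 \<noteq> 0"
    and nz: "a \<noteq> 0" "b \<noteq> 0" "c \<noteq> 0" "lam \<noteq> 0"
    and nz': "a' \<noteq> 0" "b' \<noteq> 0" "c' \<noteq> 0" "lam' \<noteq> 0"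
  shows "((a, b, c, lam), (a', b', c', lam')) \<in> {(u, v). s4step q u v}\<^sup>* \<longleftrightarrow>
    verma_invariants q (a, b, c, lam) = verma_invariants q (a', b', c', lam')"
    (is "(?x, ?x') \<in> ?R \<longleftrightarrow> _")
proof -
  obtain \<kappa> where "\<kappa>\<^sup>2 = b / (lam * q)" using alg_closed_sqrt[OF alg_closed] .
  then have adm: "admissible q \<kappa> ?x"
    using nz q(1) by (simp add: admissible_def)
  show ?thesis
  proof
    assume "(?x, ?x') \<in> ?R"
    then show "verma_invariants q ?x = verma_invariants q ?x'"
      using s4steps_verma_invariants[OF _ q(1) adm] by metis
  next
    assume inv: "verma_invariants q ?x = verma_invariants q ?x'"
    then have "b / lam = b' / lam'" by (simp add: verma_invariants_def)
    then have adm': "admissible q \<kappa> ?x'"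
      using adm nz' by (simp add: admissible_def)
    obtain x1 x2 x3 x4 where x: "s4coords \<kappa> ?x = (x1, x2, x3, x4)" by (cases "s4coords \<kappa> ?x")
    obtain y1 y2 y3 y4 where y: "s4coords \<kappa> ?x' = (y1, y2, y3, y4)" by (cases "s4coords \<kappa> ?x'")
    note ix = verma_invariants_s4coords[OF q(1) adm x]
    note iy = verma_invariants_s4coords[OF q(1) adm' y]
    define e1 f1 where "e1 = x1 + x2 + x3 + x4" and "f1 = y1 + y2 + y3 + y4"
    define e3 f3 where "e3 = x1 * x2 * (x3 + x4) + (x1 + x2) * x3 * x4"
      and "f3 = y1 * y2 * (y3 + y4) + (y1 + y2) * y3 * y4"
    have E: "e3 / (\<kappa> * q) - \<kappa> * q * e1 = f3 / (\<kappa> * q) - \<kappa> * q * f1"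
      "\<kappa> * e1 + e3 / \<kappa> = \<kappa> * f1 + f3 / \<kappa>"
      and e2: "(x1 + x2) * (x3 + x4) + x1 * x2 + x3 * x4 = (y1 + y2) * (y3 + y4) + y1 * y2 + y3 * y4"
      using inv unfolding ix(3) iy(3) e1_def f1_def e3_def f3_def by simp_all
    \<comment> \<open>The two equations \<open>E\<close> are linear in \<open>e1\<close> and
      \<open>e3\<close>, with determinant a unit times \<open>q^2 + 1\<close>.\<close>
    have "\<kappa> * (\<kappa> * e1 + e3 / \<kappa>) = \<kappa> * (\<kappa> * f1 + f3 / \<kappa>)" by (simp only: E(2))
    then have *: "\<kappa> * (\<kappa> * e1) + e3 = \<kappa> * (\<kappa> * f1) + f3"
      using ix(2) by (simp add: distrib_left)
    have "(\<kappa> * q) * (e3 / (\<kappa> * q) - \<kappa> * q * e1) = (\<kappa> * q) * (f3 / (\<kappa> * q) - \<kappa> * q * f1)"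
      by (simp only: E(1))
    then have "e3 - (\<kappa> * q) * (\<kappa> * q * e1) = f3 - (\<kappa> * q) * (\<kappa> * q * f1)"
      using ix(2) q(1) by (simp add: right_diff_distrib)
    with * have "(q\<^sup>2 + 1) * \<kappa>\<^sup>2 * (e1 - f1) = 0" by algebra
    then have e1: "e1 = f1" using q(2) ix(2) by simp
    then have e3: "e3 = f3" using * by simp
    \<comment> \<open>The predicate collects the coordinates of the points that steps reach from the
      first tuple; the adjacent swaps are then single steps.\<close>
    define Q where "Q u v w z \<longleftrightarrow>
      (\<exists>x. (?x, x) \<in> ?R \<and> admissible q \<kappa> x \<and> s4coords \<kappa> x = (u, v, w, z))" for u v w z
    have step: "(?x, x'') \<in> ?R" if "(?x, x) \<in> ?R" "s4step q x x''" for x x''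
      using that by (simp add: rtrancl.rtrancl_into_rtrancl)
    have "Q y1 y2 y3 y4"
    proof (rule swap_closed_elementary_symmetric4[where Q = Q])
      show "Q x1 x2 x3 x4" unfolding Q_def using adm x by blast
    next
      fix u v w z assume "Q u v w z"
      then obtain a b c l where r: "(?x, (a, b, c, l)) \<in> ?R"
        and ad: "admissible q \<kappa> (a, b, c, l)" and co: "s4coords \<kappa> (a, b, c, l) = (u, v, w, z)"
        unfolding Q_def by (metis prod_cases4)
      note sw = s4coords_swaps[OF q(1) ad co]
      have "s4step q (a, b, c, l) (a, b, inverse c, l)" by (simp add: s4step_def)
      from step[OF r this] show "Q v u w z" using sw(1,2) unfolding Q_def by blast
      have "s4step q (a, b, c, l) (inverse a, b, c, l)" by (simp add: s4step_def)
      from step[OF r this] show "Q u v z w" using sw(3,4) unfolding Q_def by blast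
      obtain s where s: "s\<^sup>2 = a * b * c * l * q" using alg_closed_sqrt[OF alg_closed] .
      have "s4step q (a, b, c, l) (a / s, b / s, c / s, l / s)"
        using s unfolding s4step_def by blast
      from step[OF r this] show "Q u w v z"
        using sw(5,6)[OF s] unfolding Q_def by blast
    qed (use e1[unfolded e1_def f1_def] e2 e3[unfolded e3_def f3_def] ix(1) iy(1) in \<open>simp_all only:\<close>)
    then obtain x where "(?x, x) \<in> ?R" "admissible q \<kappa> x" "s4coords \<kappa> x = s4coords \<kappa> ?x'"
      unfolding Q_def y by blast
    then show "(?x, ?x') \<in> ?R"
      using s4coords_eq_imp[OF q(1) _ adm'] step by blast
  qed
qed

section \<open>The characteristic polynomial of A\<close>

text \<open>The powers \<open>z ^ i\<close> are \<open>n\<close> distinct roots of both monic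
  polynomials of degree \<open>n\<close>, so a nonzero difference would have degree below
  \<open>n\<close> and yet \<open>n\<close> roots.\<close>

lemma prod_X_minus_root_of_unity_powers:
  fixes z :: "'a::field"
  assumes "0 < n" "z ^ n = 1" "\<And>i. 0 < i \<Longrightarrow> i < n \<Longrightarrow> z ^ i \<noteq> 1"
  shows "(\<Prod>i<n. [:- (z ^ i), 1:]) = monom 1 n - 1" (is "?p = ?r")
proof (rule ccontr)
  assume "?p \<noteq> ?r"
  then have d0: "?p - ?r \<noteq> 0" by simp
  have z: "z \<noteq> 0" using assms(1,2) by (metis power_0_left neq0_conv zero_neq_one)
  have inj: "inj_on (\<lambda>i. z ^ i) {..<n}"
  proof (rule linorder_inj_onI')
    fix i j assume "i \<in> {..<n}" "j \<in> {..<n}" "i < j"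
    then have "z ^ (j - i) \<noteq> 1" by (intro assms(3)) auto
    moreover have "z ^ j = z ^ i * z ^ (j - i)" using \<open>i < j\<close> by (simp flip: power_add)
    ultimately show "z ^ i \<noteq> z ^ j" using z by auto
  qed
  have deg: "degree ?p = n" by (simp add: degree_prod_sum_eq)
  then have lc: "coeff ?p n = 1" using lead_coeff_prod[of "\<lambda>i. [:- (z ^ i), 1:]" "{..<n}"] by simp
  have "degree (?p - ?r) \<le> n"
    using deg by (intro degree_diff_le) (auto simp: degree_monom_le)
  moreover have "coeff (?p - ?r) n = 0" using lc assms(1) by simp
  ultimately have "degree (?p - ?r) < n"
    using d0 by (metis le_neq_implies_less leading_coeff_0_iff)
  moreover have "(\<lambda>i. z ^ i) ` {..<n} \<subseteq> {x. poly (?p - ?r) x = 0}"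
  proof (intro image_subsetI CollectI)
    fix i assume "i \<in> {..<n}"
    then have "(\<Prod>j<n. z ^ i - z ^ j) = 0" by (auto simp: prod_zero_iff)
    moreover have "(z ^ i) ^ n = 1" using assms(2) by (metis mult.commute power_mult power_one)
    ultimately show "poly (?p - ?r) (z ^ i) = 0" by (simp add: poly_prod poly_monom)
  qed
  then have "card ((\<lambda>i. z ^ i) ` {..<n}) \<le> card {x. poly (?p - ?r) x = 0}"
    using poly_roots_finite[OF d0] by (rule card_mono[rotated])
  then have "n \<le> card {x. poly (?p - ?r) x = 0}" by (simp add: card_image inj)
  ultimately show False using card_poly_roots_bound[OF d0] by simp
qed

lemma prod_diff_root_of_unity_powers:
  fixes z :: "'a::field"
  assumes "0 < n" "z ^ n = 1" "\<And>i. 0 < i \<Longrightarrow> i < n \<Longrightarrow> z ^ i \<noteq> 1" "x \<noteq> 0"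
  shows "(\<Prod>i<n. y - x * z ^ i) = y ^ n - x ^ n"
proof -
  have "(\<Prod>i<n. y - x * z ^ i) = (\<Prod>i<n. x * poly [:- (z ^ i), 1:] (y / x))"
    using assms(4) by (intro prod.cong refl) (simp add: algebra_simps)
  also have "\<dots> = x ^ n * poly (\<Prod>i<n. [:- (z ^ i), 1:]) (y / x)"
    by (simp add: prod.distrib poly_prod)
  also have "\<dots> = y ^ n - x ^ n"
    using assms(4)
    by (subst prod_X_minus_root_of_unity_powers[OF assms(1-3)])
      (simp_all add: poly_monom power_divide right_diff_distrib)
  finally show ?thesis .
qed

section \<open>The multiplicative order of \<open>q^2\<close>\<close>

lemma root_order_props:
  fixes q :: "'a::field"
  assumes "\<exists>n>0. q ^ n = 1"
  shows "0 < root_order q" "q ^ root_order q = 1"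
    "\<And>i. 0 < i \<Longrightarrow> i < root_order q \<Longrightarrow> q ^ i \<noteq> 1"
  using LeastI_ex[of "\<lambda>d. 0 < d \<and> q ^ d = 1"] assms not_less_Least[of _ "\<lambda>d. 0 < d \<and> q ^ d = 1"]
  unfolding root_order_def by blast+

text \<open>\<open>dprime q\<close> is the order of \<open>q^2\<close>, hence a common period of
  \<open>theta\<close>, \<open>thetas\<close> and \<open>phi\<close>. The orders 1, 2 and 4 of
  \<open>q\<close> are those that make it smaller than 3.\<close>

lemma dprime_props:
  fixes q :: "'a::field"
  assumes root: "\<exists>n>0. q ^ n = 1" and ord: "root_order q \<notin> {1, 2, 4}"
  shows "q \<noteq> 0" "3 \<le> dprime q" "(q\<^sup>2) ^ dprime q = 1"
    "\<And>i. 0 < i \<Longrightarrow> i < dprime q \<Longrightarrow> (q\<^sup>2) ^ i \<noteq> 1"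
proof -
  let ?d = "root_order q"
  note d = root_order_props[OF root]
  show "q \<noteq> 0" using root by (metis power_0_left neq0_conv zero_neq_one)
  show "3 \<le> dprime q" using d(1) ord unfolding dprime_def
    by (cases "odd ?d") (auto elim!: oddE evenE)
  show "(q\<^sup>2) ^ dprime q = 1"
  proof (cases "odd ?d")
    case True
    then show ?thesis
      unfolding dprime_def using d(2) by (simp add: power_mult[symmetric] mult.commute[of 2] power_mult)
  next
    case False
    then have "2 * (?d div 2) = ?d" by simp
    then show ?thesis
      unfolding dprime_def using d(2) False by (simp add: power_mult[symmetric])
  qed
  fix i assume i: "0 < i" "i < dprime q"
  show "(q\<^sup>2) ^ i \<noteq> 1"
  proof
    assume "(q\<^sup>2) ^ i = 1"
    then have qi: "q ^ (2 * i) = 1" by (simp add: power_mult)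
    show False
    proof (cases "2 * i < ?d")
      case True
      then show False using d(3)[of "2 * i"] i qi by simp
    next
      case False
      \<comment> \<open>Here \<open>i < dprime q\<close> forces the odd case. Then
        \<open>2 * i\<close> differs from \<open>?d\<close>, and \<open>2 * i - ?d\<close> is a
        positive exponent below the order.\<close>
      then have odd: "odd ?d" and "i < ?d" using i unfolding dprime_def by (auto split: if_splits)
      then have "?d < 2 * i" using False by (metis dvd_triv_left linorder_neqE_nat)
      then have "q ^ (2 * i) = q ^ ?d * q ^ (2 * i - ?d)" by (simp flip: power_add)
      then have "q ^ (2 * i - ?d) = 1" using qi d(2) by simp
      then show False using d(3)[of "2 * i - ?d"] \<open>?d < 2 * i\<close> \<open>i < ?d\<close> by simp
    qed
  qed
qed

lemma q_nondegenerate: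
  fixes q :: "'a::field"
  assumes root: "\<exists>n>0. q ^ n = 1" and ord: "root_order q \<notin> {1, 2, 4}"
  shows "q\<^sup>2 + 1 \<noteq> 0" "q - inverse q \<noteq> 0" "q\<^sup>2 - (inverse q)\<^sup>2 \<noteq> 0"
proof -
  note p = dprime_props[OF assms]
  have q2: "q\<^sup>2 \<noteq> 1" and q4: "(q\<^sup>2) ^ 2 \<noteq> 1" using p(2) p(4)[of 1] p(4)[of 2] by simp_all
  show "q\<^sup>2 + 1 \<noteq> 0"
  proof
    assume "q\<^sup>2 + 1 = 0"
    then have "q\<^sup>2 = - 1" by (simp add: eq_neg_iff_add_eq_0)
    then show False using q4 by simp
  qed
  have "q * (q - inverse q) = q\<^sup>2 - 1" using p(1) by (simp add: right_diff_distrib power2_eq_square)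
  then show "q - inverse q \<noteq> 0" using q2 by auto
  have "q\<^sup>2 * (q\<^sup>2 - (inverse q)\<^sup>2) = (q\<^sup>2) ^ 2 - 1"
    using p(1) by (simp add: field_simps power2_eq_square)
  then show "q\<^sup>2 - (inverse q)\<^sup>2 \<noteq> 0" using q4 by auto
qed

definition newton_poly :: "'a::field \<Rightarrow> 'a \<Rightarrow> 'a \<Rightarrow> nat \<Rightarrow> 'a poly" where
  "newton_poly q a lam n = (\<Prod>i<n. [:- theta q a lam i, 1:])"

text \<open>The product of the \<open>A - theta i\<close> over one period takes \<open>m_0\<close>
  to \<open>m_d'\<close>, so the relation \<open>m_d' = delta m_0\<close> says that this polynomial
  in A kills \<open>w_0\<close>.\<close>

definition A_charpoly :: "'a::field \<Rightarrow> 'a \<Rightarrow> 'a \<Rightarrow> 'a \<Rightarrow> 'a poly" where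
  "A_charpoly q a lam delta = newton_poly q a lam (dprime q) - [:delta:]"

lemma degree_newton_poly: "degree (newton_poly q a lam n) = n"
  by (simp add: newton_poly_def degree_prod_sum_eq)

lemma lead_coeff_newton_poly: "coeff (newton_poly q a lam n) n = 1"
  using lead_coeff_prod[of "\<lambda>i. [:- theta q a lam i, 1:]" "{..<n}"] degree_newton_poly[of q a lam n]
  by (simp add: newton_poly_def)

lemma A_charpoly_monic:
  assumes "0 < dprime q"
  shows "degree (A_charpoly q a lam delta) = dprime q" "lead_coeff (A_charpoly q a lam delta) = 1"
proof -
  show *: "degree (A_charpoly q a lam delta) = dprime q"
    unfolding A_charpoly_def diff_conv_add_uminus
    using assms by (subst degree_add_eq_left) (simp_all add: degree_newton_poly)
  show "lead_coeff (A_charpoly q a lam delta) = 1"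
    unfolding * using assms
    by (cases "dprime q") (simp_all add: A_charpoly_def lead_coeff_newton_poly)
qed

text \<open>With \<open>z = y + 1/y\<close> each factor \<open>z - \<theta>\<^sub>i\<close> splits, so the product is a
  Chebyshev polynomial in \<open>z\<close> up to a constant.\<close>
lemma poly_A_charpoly:
  fixes q :: "'a::field"
  assumes root: "\<exists>n>0. q ^ n = 1" and ord: "root_order q \<notin> {1, 2, 4}"
    and nz: "a \<noteq> 0" "lam \<noteq> 0" "y \<noteq> 0"
  shows "poly (A_charpoly q a lam delta) (y + inverse y) =
    y ^ dprime q + inverse y ^ dprime q
      - (delta + (a / lam) ^ dprime q + (lam / a) ^ dprime q)"
proof -
  note p = dprime_props[OF root ord]
  define n where "n = dprime q"
  define z where "z = q\<^sup>2"
  define x where "x = a / lam"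
  have x: "x \<noteq> 0" and ix: "lam / a = inverse x" using nz by (simp_all add: x_def)
  have z: "z ^ n = 1" "\<And>i. 0 < i \<Longrightarrow> i < n \<Longrightarrow> z ^ i \<noteq> 1" and n: "0 < n" and z0: "z \<noteq> 0"
    using p unfolding n_def z_def by auto
  have "poly (newton_poly q a lam n) (y + inverse y)
      = (\<Prod>i<n. (y - x * z ^ i) * (1 - inverse (x * y) * inverse z ^ i))"
    unfolding newton_poly_def poly_prod
  proof (intro prod.cong refl)
    fix i
    have "theta q a lam i = x * z ^ i + inverse x * inverse z ^ i"
      by (simp add: theta_def z_def power_mult x_def power_inverse)
    moreover have inv: "x * inverse x = 1" "y * inverse y = 1" "z ^ i * inverse z ^ i = 1"
      using x z0 nz(3) by (simp_all add: power_inverse)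
    have "(y - x * w) * (1 - xi * yi * wi) = y + yi - (x * w + xi * wi)"
      if "x * xi = 1" "y * yi = 1" "w * wi = 1" for xi yi w wi
      using that by algebra
    from this[OF inv] have "(y - x * z ^ i) * (1 - inverse (x * y) * inverse z ^ i)
        = y + inverse y - (x * z ^ i + inverse x * inverse z ^ i)"
      unfolding inverse_mult_distrib .
    ultimately show "poly [:- theta q a lam i, 1:] (y + inverse y)
        = (y - x * z ^ i) * (1 - inverse (x * y) * inverse z ^ i)" by simp
  qed
  \<comment> \<open>The two products run over the powers of \<open>z\<close> and of
    \<open>inverse z\<close>, both primitive roots of unity of order \<open>n\<close>.\<close>
  also have "\<dots> = (y ^ n - x ^ n) * (1 ^ n - inverse (x * y) ^ n)"
    unfolding prod.distrib using n z x nz(3)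
    by (subst (1 2) prod_diff_root_of_unity_powers) (simp_all add: power_inverse)
  also have "\<dots> = y ^ n + inverse y ^ n - x ^ n - inverse x ^ n"
    using x nz(3) by (simp add: field_simps)
  finally show ?thesis
    by (simp add: A_charpoly_def n_def[symmetric] x_def[symmetric] ix)
qed

text \<open>Over a finite field, one plus the product of all \<open>X - u\<close> would be a
  nonconstant polynomial with the value 1 everywhere.\<close>

lemma alg_closed_infinite:
  assumes "\<forall>p::'a::field poly. 0 < degree p \<longrightarrow> (\<exists>x. poly p x = 0)"
  shows "infinite (UNIV :: 'a set)"
proof
  assume fin: "finite (UNIV :: 'a set)"
  let ?p = "(\<Prod>u\<in>UNIV. [:-u, 1:]) :: 'a poly"
  have "degree ?p = card (UNIV :: 'a set)" by (simp add: degree_prod_sum_eq)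
  then have "0 < degree ?p" using fin by (simp add: card_gt_0_iff)
  then have "0 < degree (?p + 1)" by (subst degree_add_eq_left) simp_all
  then obtain x where "poly (?p + 1) x = 0" using assms by blast
  moreover have "poly ?p x = 0" using fin by (simp add: poly_prod prod_zero_iff)
  ultimately show False by simp
qed

text \<open>Evaluation at \<open>y = 1\<close> gives one direction. For the other, every
  \<open>z\<close> is \<open>y + 1/y\<close> for a root \<open>y\<close> of
  \<open>Y^2 - z Y + 1\<close>, so the two polynomials agree at all points of an infinite
  field.\<close>

lemma A_charpoly_eq_iff:
  fixes q :: "'a::field"
  assumes alg_closed: "\<forall>p::'a poly. 0 < degree p \<longrightarrow> (\<exists>x. poly p x = 0)"
    and q: "\<exists>n>0. q ^ n = 1" "root_order q \<notin> {1, 2, 4}"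
    and nz: "a \<noteq> 0" "lam \<noteq> 0" "a' \<noteq> 0" "lam' \<noteq> 0"
  shows "A_charpoly q a lam delta = A_charpoly q a' lam' delta' \<longleftrightarrow>
    delta + (a / lam) ^ dprime q + (lam / a) ^ dprime q
      = delta' + (a' / lam') ^ dprime q + (lam' / a') ^ dprime q" (is "?P = ?P' \<longleftrightarrow> ?e = ?e'")
proof
  assume "?P = ?P'"
  then have "1 ^ dprime q + inverse 1 ^ dprime q - ?e = 1 ^ dprime q + inverse 1 ^ dprime q - ?e'"
    using poly_A_charpoly[OF q nz(1,2), of 1 delta] poly_A_charpoly[OF q nz(3,4), of 1 delta']
    by (metis one_neq_zero)
  then show "?e = ?e'" by (rule diff_left_imp_eq)
next
  assume e: "?e = ?e'"
  have "poly ?P z = poly ?P' z" for z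
  proof -
    obtain y where "poly [:1, -z, 1:] y = 0"
      using alg_closed[rule_format, of "[:1, -z, 1:]"] by auto
    then have y: "y * (z - y) = 1" by (simp add: algebra_simps)
    then have "y \<noteq> 0" by auto
    moreover from this have "z = y + inverse y" using y by (simp add: field_simps)
    ultimately show ?thesis
      using poly_A_charpoly[OF q nz(1,2), of y delta] poly_A_charpoly[OF q nz(3,4), of y delta'] e by simp
  qed
  then have "{x. poly (?P - ?P') x = 0} = UNIV" by simp
  then show "?P = ?P'"
    using alg_closed_infinite[OF alg_closed] poly_roots_finite[of "?P - ?P'"] by auto
qed

section \<open>The Verma module as a polynomial ring\<close>

text \<open>The coordinates of \<open>p(A) m_0\<close>, computed by Horner's scheme. As the vectors
  \<open>A^n m_0\<close> form a basis, this identifies F[X] with M and turns A into multiplication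
  by X.\<close>

definition cyc :: "'a::field \<Rightarrow> 'a \<Rightarrow> 'a \<Rightarrow> 'a poly \<Rightarrow> nat \<Rightarrow> 'a" where
  "cyc q a lam p = fold_coeffs (\<lambda>c f j. c * basisv 0 j + actA q a lam f j) p (\<lambda>_. 0)"

lemma actA_linear:
  "actA q a lam (\<lambda>j. f j + g j) = (\<lambda>j. actA q a lam f j + actA q a lam g j)"
  "actA q a lam (\<lambda>j. s * f j) = (\<lambda>j. s * actA q a lam f j)"
  "actA q a lam (\<lambda>j. 0) = (\<lambda>j. 0)"
  by (auto simp: actA_def fun_eq_iff algebra_simps)

lemma actB_linear:
  "actB q a b c lam (\<lambda>j. f j + g j) = (\<lambda>j. actB q a b c lam f j + actB q a b c lam g j)"
  "actB q a b c lam (\<lambda>j. s * f j) = (\<lambda>j. s * actB q a b c lam f j)"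
  "actB q a b c lam (\<lambda>j. 0) = (\<lambda>j. 0)"
  by (auto simp: actB_def fun_eq_iff algebra_simps)

lemma cyc_0 [simp]: "cyc q a lam 0 = (\<lambda>j. 0)"
  by (simp add: cyc_def)

lemma cyc_pCons: "cyc q a lam (pCons c p) = (\<lambda>j. c * basisv 0 j + actA q a lam (cyc q a lam p) j)"
proof (cases "p = 0 \<and> c = 0")
  case True
  then show ?thesis by (simp add: actA_linear)
next
  case False
  then show ?thesis by (auto simp: cyc_def)
qed

lemma cyc_add: "cyc q a lam (p + r) = (\<lambda>j. cyc q a lam p j + cyc q a lam r j)"
proof (induction p r rule: poly_induct2)
  case (pCons c p d r)
  then show ?case by (simp add: cyc_pCons actA_linear algebra_simps)
qed simp

lemma cyc_smult: "cyc q a lam (smult s p) = (\<lambda>j. s * cyc q a lam p j)"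
  by (induction p) (simp_all add: cyc_pCons actA_linear algebra_simps)

lemma cyc_diff: "cyc q a lam (p - r) = (\<lambda>j. cyc q a lam p j - cyc q a lam r j)"
  using cyc_add[of q a lam p "smult (-1) r"] cyc_smult[of q a lam "-1" r] by simp

lemma cyc_shift: "cyc q a lam (pCons 0 p) = actA q a lam (cyc q a lam p)"
  by (simp add: cyc_pCons)

lemma cyc_const: "cyc q a lam [:s:] = (\<lambda>j. s * basisv 0 j)"
  by (simp add: cyc_pCons actA_linear)

text \<open>A raises the top index by one and keeps the top coefficient, so the map is triangular
  with respect to the degree; its bijectivity onto \<open>FS\<close> rests on this.\<close>

lemma cyc_degree:
  "cyc q a lam p (degree p) = lead_coeff p" "degree p < j \<Longrightarrow> cyc q a lam p j = 0"
proof -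
  have "cyc q a lam p (degree p) = lead_coeff p \<and> (\<forall>j>degree p. cyc q a lam p j = 0)"
  proof (induction p)
    case (pCons c p)
    then show ?case
      by (cases "p = 0") (auto simp: cyc_pCons actA_def basisv_def)
  qed simp
  then show "cyc q a lam p (degree p) = lead_coeff p" "degree p < j \<Longrightarrow> cyc q a lam p j = 0"
    by blast+
qed

lemma cyc_eq_0_iff: "cyc q a lam p = (\<lambda>j. 0) \<longleftrightarrow> p = 0"
  using cyc_degree(1)[of q a lam p] by (auto simp: leading_coeff_0_iff)

lemma cyc_inject: "cyc q a lam p = cyc q a lam r \<longleftrightarrow> p = r"
  using cyc_eq_0_iff[of q a lam "p - r"] by (auto simp: cyc_diff fun_eq_iff)

lemma cyc_in_FS: "cyc q a lam p \<in> FS"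
proof -
  have "{i. cyc q a lam p i \<noteq> 0} \<subseteq> {..degree p}"
    using cyc_degree(2) by (metis (mono_tags) atMost_iff mem_Collect_eq not_le subsetI)
  then show ?thesis unfolding FS_def by (simp add: finite_subset)
qed

lemma cyc_surj:
  assumes "f \<in> FS"
  obtains p where "f = cyc q a lam p"
proof -
  have "\<exists>p. f = cyc q a lam p" if "\<forall>j\<ge>n. f j = 0" for n and f :: "nat \<Rightarrow> 'a"
    using that
  proof (induction n arbitrary: f)
    case 0
    then have "f = cyc q a lam 0" by (simp add: fun_eq_iff)
    then show ?case ..
  next
    case (Suc n)
    let ?m = "monom (f n) n"
    have m: "cyc q a lam ?m n = f n" "n < j \<Longrightarrow> cyc q a lam ?m j = 0" for j
    proof -
      have "degree ?m = n" if "f n \<noteq> 0" using that by (rule degree_monom_eq)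
      then show "cyc q a lam ?m n = f n" "n < j \<Longrightarrow> cyc q a lam ?m j = 0"
        using cyc_degree(1)[of q a lam ?m] cyc_degree(2)[of ?m j q a lam]
        by (cases "f n = 0", simp_all)+
    qed
    have "\<forall>j\<ge>n. f j - cyc q a lam ?m j = 0"
    proof (intro allI impI)
      fix j assume "n \<le> j"
      then show "f j - cyc q a lam ?m j = 0"
        using Suc.prems m by (cases "j = n") auto
    qed
    from Suc.IH[OF this] obtain p where p: "(\<lambda>j. f j - cyc q a lam ?m j) = cyc q a lam p" ..
    have "f = cyc q a lam (p + ?m)"
      unfolding cyc_add p[symmetric] by simp
    then show ?case ..
  qed
  moreover have "\<exists>n. \<forall>j\<in>{i. f i \<noteq> 0}. j < n"
    using assms unfolding FS_def by (simp only: mem_Collect_eq finite_nat_set_iff_bounded)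
  then obtain n where "\<forall>j\<ge>n. f j = 0" by (meson leD mem_Collect_eq)
  ultimately show thesis using that by blast
qed

lemma FS_eq_range_cyc: "FS = range (cyc q a lam)"
  using cyc_in_FS cyc_surj by blast

lemma cyc_newton_poly: "cyc q a lam (newton_poly q a lam n) = basisv n"
proof (induction n)
  case 0
  show ?case by (simp add: newton_poly_def one_pCons cyc_const)
next
  case (Suc n)
  have "newton_poly q a lam (Suc n)
      = pCons 0 (newton_poly q a lam n) - smult (theta q a lam n) (newton_poly q a lam n)"
    by (simp add: newton_poly_def mult.commute)
  then show ?case
    by (auto simp: cyc_diff cyc_shift cyc_smult Suc.IH actA_def basisv_def fun_eq_iff)
qed

section \<open>Periodicity of the action and the submodule divided out\<close>

definition shiftd :: "nat \<Rightarrow> (nat \<Rightarrow> 'a::zero) \<Rightarrow> nat \<Rightarrow> 'a" where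
  "shiftd n f = (\<lambda>j. if n \<le> j then f (j - n) else 0)"

lemma theta_periodic:
  assumes "(q\<^sup>2) ^ n = (1::'a::field)"
  shows "theta q a lam (n + i) = theta q a lam i"
proof -
  have "inverse ((q\<^sup>2) ^ n) = 1" using assms by simp
  then have "(inverse q ^ 2) ^ n = 1" by (simp add: power_inverse)
  then show ?thesis using assms by (simp add: theta_def power_mult power_add)
qed

lemma phi_periodic:
  fixes q :: "'a::field"
  assumes nz: "q \<noteq> 0" "a \<noteq> 0" "b \<noteq> 0" "c \<noteq> 0" "lam \<noteq> 0" and "(q\<^sup>2) ^ n = 1"
  shows "phi q a b c lam (n + i) = phi q a b c lam i"
proof -
  have "(q ^ (n + i))\<^sup>2 = (q\<^sup>2) ^ n * (q ^ i)\<^sup>2"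
    by (simp add: power_add power_mult_distrib flip: power_mult) (simp add: mult.commute)
  then show ?thesis unfolding phi_eq[OF nz] using assms(6) by simp
qed

lemma actA_shiftd:
  assumes "(q\<^sup>2) ^ n = (1::'a::field)"
  shows "actA q a lam (shiftd n f) = shiftd n (actA q a lam f)"
proof
  fix j
  show "actA q a lam (shiftd n f) j = shiftd n (actA q a lam f) j"
  proof (cases "n \<le> j")
    case True
    then obtain i where "j = n + i" using le_Suc_ex by blast
    then show ?thesis
      using theta_periodic[OF assms, of a lam i]
      by (cases i; cases n; simp add: actA_def shiftd_def)
  qed (simp add: actA_def shiftd_def)
qed

text \<open>Besides periodicity this uses \<open>phi n = phi 0 = 0\<close>: a nonzero value would
  let B carry \<open>m_n\<close> to \<open>m_(n-1)\<close>, below the shifted range.\<close>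

lemma actB_shiftd:
  fixes q :: "'a::field"
  assumes nz: "q \<noteq> 0" "a \<noteq> 0" "b \<noteq> 0" "c \<noteq> 0" "lam \<noteq> 0" and "(q\<^sup>2) ^ n = 1"
  shows "actB q a b c lam (shiftd n f) = shiftd n (actB q a b c lam f)"
proof
  fix j
  have ph: "phi q a b c lam n = 0"
    using phi_periodic[OF assms, of 0] by (simp add: phi_def)
  show "actB q a b c lam (shiftd n f) j = shiftd n (actB q a b c lam f) j"
  proof (cases "n \<le> j")
    case True
    then obtain i where "j = n + i" using le_Suc_ex by blast
    then show ?thesis
      using theta_periodic[OF assms(6), of b lam i] phi_periodic[OF assms, of "Suc i"]
      by (simp add: actB_def shiftd_def thetas_theta Suc_diff_le)
  next
    case False
    then show ?thesis using ph by (cases "Suc j = n") (auto simp: actB_def shiftd_def)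
  qed
qed

text \<open>The factor takes \<open>m_0\<close> to \<open>m_n\<close>, and the shift by a period
  commutes with A, so multiplying by it shifts all indices by \<open>n\<close>.\<close>

lemma cyc_newton_poly_mult:
  assumes "(q\<^sup>2) ^ n = (1::'a::field)"
  shows "cyc q a lam (newton_poly q a lam n * p) = shiftd n (cyc q a lam p)"
proof (induction p)
  case 0
  then show ?case by (simp add: shiftd_def)
next
  case (pCons s p)
  have "newton_poly q a lam n * pCons s p
      = smult s (newton_poly q a lam n) + pCons 0 (newton_poly q a lam n * p)"
    by (simp add: mult.commute[of "newton_poly q a lam n"])
  then have "cyc q a lam (newton_poly q a lam n * pCons s p)
      = (\<lambda>j. s * basisv n j + shiftd n (actA q a lam (cyc q a lam p)) j)"
    by (simp add: cyc_add cyc_smult cyc_shift cyc_newton_poly pCons.IH actA_shiftd[OF assms])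
  also have "\<dots> = shiftd n (cyc q a lam (pCons s p))"
    by (auto simp: cyc_pCons shiftd_def basisv_def fun_eq_iff)
  finally show ?case .
qed

lemma Nsub_shiftd: "Nsub q delta = {v. \<exists>g\<in>FS. v = (\<lambda>j. delta * g j - shiftd (dprime q) g j)}"
  by (simp add: Nsub_def shiftd_def)

text \<open>Multiplication by P is the shift by one period minus \<open>delta\<close>, so the span
  divided out corresponds to the principal ideal of P.\<close>

lemma cyc_in_Nsub_iff:
  fixes q :: "'a::field"
  assumes "(q\<^sup>2) ^ dprime q = 1"
  shows "cyc q a lam p \<in> Nsub q delta \<longleftrightarrow> A_charpoly q a lam delta dvd p"
proof -
  have "cyc q a lam (A_charpoly q a lam delta * r)
      = (\<lambda>j. shiftd (dprime q) (cyc q a lam r) j - delta * cyc q a lam r j)" for r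
    by (simp add: A_charpoly_def left_diff_distrib cyc_diff cyc_smult cyc_newton_poly_mult[OF assms])
  then have *: "(\<lambda>j. delta * cyc q a lam r j - shiftd (dprime q) (cyc q a lam r) j)
      = cyc q a lam (A_charpoly q a lam delta * (- r))" for r
    using cyc_diff[of q a lam 0 "A_charpoly q a lam delta * r"] by simp
  show ?thesis
  proof
    assume "cyc q a lam p \<in> Nsub q delta"
    then obtain g where "g \<in> FS" and g: "cyc q a lam p = (\<lambda>j. delta * g j - shiftd (dprime q) g j)"
      unfolding Nsub_shiftd by blast
    then obtain r where "g = cyc q a lam r" by (elim cyc_surj)
    then have "p = A_charpoly q a lam delta * (- r)"
      using g * by (simp only: cyc_inject)
    then show "A_charpoly q a lam delta dvd p" by (rule dvdI)
  next
    assume "A_charpoly q a lam delta dvd p"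
    then obtain r where "p = A_charpoly q a lam delta * (- (- r))" by (auto elim: dvdE)
    then have "cyc q a lam p
        = (\<lambda>j. delta * cyc q a lam (- r) j - shiftd (dprime q) (cyc q a lam (- r)) j)"
      by (simp only: *)
    then show "cyc q a lam p \<in> Nsub q delta"
      unfolding Nsub_shiftd using cyc_in_FS by blast
  qed
qed

section \<open>B as an operator on polynomials\<close>

lemma actB_in_FS:
  assumes "f \<in> FS"
  shows "actB q a b c lam f \<in> FS"
proof -
  let ?S = "{i. f i \<noteq> 0}"
  have "{i. actB q a b c lam f i \<noteq> 0} \<subseteq> ?S \<union> (\<lambda>i. i - 1) ` ?S"
  proof
    fix i assume "i \<in> {i. actB q a b c lam f i \<noteq> 0}"
    then have "f i \<noteq> 0 \<or> f (Suc i) \<noteq> 0" by (auto simp: actB_def)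
    then show "i \<in> ?S \<union> (\<lambda>i. i - 1) ` ?S"
      by (metis (mono_tags, lifting) UnI1 UnI2 diff_Suc_1 imageI mem_Collect_eq)
  qed
  moreover have "finite (?S \<union> (\<lambda>i. i - 1) ` ?S)" using assms by (simp add: FS_def)
  ultimately show ?thesis unfolding FS_def by (simp add: finite_subset)
qed

text \<open>B transported to F[X] along \<open>cyc\<close>, which is a bijection onto
  \<open>FS\<close>.\<close>

definition bpoly :: "'a::field \<Rightarrow> 'a \<Rightarrow> 'a \<Rightarrow> 'a \<Rightarrow> 'a \<Rightarrow> 'a poly \<Rightarrow> 'a poly" where
  "bpoly q a b c lam p = (THE r. cyc q a lam r = actB q a b c lam (cyc q a lam p))"

lemma cyc_bpoly: "cyc q a lam (bpoly q a b c lam p) = actB q a b c lam (cyc q a lam p)"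
proof -
  obtain r where r: "actB q a b c lam (cyc q a lam p) = cyc q a lam r"
    using cyc_surj[OF actB_in_FS[OF cyc_in_FS]] by blast
  then have "bpoly q a b c lam p = r"
    unfolding bpoly_def by (simp add: cyc_inject)
  then show ?thesis using r by simp
qed

lemma bpoly_eqI: "cyc q a lam r = actB q a b c lam (cyc q a lam p) \<Longrightarrow> bpoly q a b c lam p = r"
  by (metis cyc_bpoly cyc_inject)

lemma degree_bpoly_le: "degree (bpoly q a b c lam p) \<le> degree p"
proof (rule ccontr)
  let ?r = "bpoly q a b c lam p"
  assume "\<not> degree ?r \<le> degree p"
  then have "cyc q a lam ?r (degree ?r) = 0"
    unfolding cyc_bpoly by (simp add: actB_def cyc_degree(2))
  then have "?r = 0" unfolding cyc_degree(1) by simp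
  with \<open>\<not> degree ?r \<le> degree p\<close> show False by simp
qed

lemma bpoly_add: "bpoly q a b c lam (p + r) = bpoly q a b c lam p + bpoly q a b c lam r"
  by (rule bpoly_eqI) (simp add: cyc_add cyc_bpoly actB_linear)

lemma bpoly_smult: "bpoly q a b c lam (smult s p) = smult s (bpoly q a b c lam p)"
  by (rule bpoly_eqI) (simp add: cyc_smult cyc_bpoly actB_linear)

lemma bpoly_diff: "bpoly q a b c lam (p - r) = bpoly q a b c lam p - bpoly q a b c lam r"
  using bpoly_add[of q a b c lam p "smult (-1) r"] bpoly_smult[of q a b c lam "-1" r] by simp

lemma bpoly_1: "bpoly q a b c lam [:1:] = [:b / lam + lam / b:]"
  by (rule bpoly_eqI) (auto simp: cyc_const actB_def basisv_def thetas_def fun_eq_iff)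

lemma verma_invariants_eq_iff:
  "verma_invariants q (a, b, c, lam) = verma_invariants q (a', b', c', lam') \<longleftrightarrow>
    b / lam = b' / lam' \<and> iotaM q a b c lam = iotaM q a' b' c' lam' \<and>
    gammaM q a b c lam = gammaM q a' b' c' lam' \<and> gammaM q c a b lam = gammaM q c' a' b' lam'"
  by (simp add: verma_invariants_def)

context
  fixes q a b c lam :: "'a::field"
  assumes nz: "q \<noteq> 0" "a \<noteq> 0" "b \<noteq> 0" "c \<noteq> 0" "lam \<noteq> 0"
begin

text \<open>\<open>A m_0\<close> is \<open>theta 0\<close> times \<open>m_0\<close> plus
  \<open>m_1\<close>. After B is applied and \<open>m_1\<close> is written as
  \<open>A - theta 0\<close> acting on \<open>m_0\<close>, the left side is the constant term that
  remains.\<close>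

lemma phi_1_iotaM:
  "thetas q b lam 0 * theta q a lam 0 + phi q a b c lam 1 - thetas q b lam 1 * theta q a lam 0
    = (q - inverse q) * iotaM q a b c lam"
proof -
  define ai bi qi l li S where defs: "ai = inverse a" "bi = inverse b" "qi = inverse q" "l = lam"
    "li = inverse lam" "S = c + inverse c"
  have inv: "a * ai = 1" "b * bi = 1" "q * qi = 1" "l * li = 1"
    using nz by (simp_all add: defs)
  note inv = inv inv[THEN cancel_pair]
  have "phi q a b c lam 1 = (q * li + l * qi - (l * q + li * qi)) * (a * b * q * li + l * ai * bi * qi - S)"
    unfolding phi_eq[OF nz] using nz by (simp add: defs divide_inverse power2_eq_square mult_ac)
  moreover have "theta q a lam 0 = a * li + l * ai"
    "thetas q b lam 0 = b * li + l * bi" "thetas q b lam 1 = b * li * (q * q) + l * bi * (qi * qi)"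
    by (simp_all add: theta_def thetas_def defs divide_inverse power2_eq_square)
  moreover have "iotaM q a b c lam = (a + ai) * (bi * qi - b * q) - S * (li - l)" "inverse q = qi"
    by (simp_all add: iotaM_def defs)
  ultimately show ?thesis by (simp only:) (simp add: algebra_simps inv)
qed

lemma bpoly_X: "bpoly q a b c lam [:0, 1:] =
    [:(q - inverse q) * iotaM q a b c lam, b / lam * q\<^sup>2 + lam / b * (inverse q)\<^sup>2:]"
proof (rule bpoly_eqI)
  have t: "b / lam * q\<^sup>2 + lam / b * (inverse q)\<^sup>2 = thetas q b lam 1"
    by (simp add: thetas_def)
  show "cyc q a lam [:(q - inverse q) * iotaM q a b c lam, b / lam * q\<^sup>2 + lam / b * (inverse q)\<^sup>2:]
    = actB q a b c lam (cyc q a lam [:0, 1:])"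
  proof
    fix j :: nat
    consider "j = 0" | "j = 1" | "2 \<le> j" by linarith
    then show "cyc q a lam [:(q - inverse q) * iotaM q a b c lam, b / lam * q\<^sup>2 + lam / b * (inverse q)\<^sup>2:] j
      = actB q a b c lam (cyc q a lam [:0, 1:]) j"
      unfolding t phi_1_iotaM[symmetric]
      by cases (simp_all add: cyc_pCons actA_def actB_def basisv_def)
  qed
qed

text \<open>The Askey--Wilson relation solved for its term \<open>B A^2\<close>: a second-order
  recursion for B in powers of X, with \<gamma> and \<beta> in its coefficients.\<close>

lemma bpoly_X_squared:
  "bpoly q a b c lam (pCons 0 (pCons 0 p)) =
    smult (q\<^sup>2 + (inverse q)\<^sup>2) (pCons 0 (bpoly q a b c lam (pCons 0 p)))
    - pCons 0 (pCons 0 (bpoly q a b c lam p))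
    - smult ((q\<^sup>2 - (inverse q)\<^sup>2)\<^sup>2) (bpoly q a b c lam p)
    - smult ((q - inverse q)\<^sup>2 * gammaM q a b c lam) (pCons 0 p)
    + smult ((q\<^sup>2 - (inverse q)\<^sup>2) * (q - inverse q) * gammaM q c a b lam) p"
proof (rule bpoly_eqI)
  show "cyc q a lam (smult (q\<^sup>2 + (inverse q)\<^sup>2) (pCons 0 (bpoly q a b c lam (pCons 0 p)))
    - pCons 0 (pCons 0 (bpoly q a b c lam p))
    - smult ((q\<^sup>2 - (inverse q)\<^sup>2)\<^sup>2) (bpoly q a b c lam p)
    - smult ((q - inverse q)\<^sup>2 * gammaM q a b c lam) (pCons 0 p)
    + smult ((q\<^sup>2 - (inverse q)\<^sup>2) * (q - inverse q) * gammaM q c a b lam) p)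
    = actB q a b c lam (cyc q a lam (pCons 0 (pCons 0 p)))" (is "?L = ?R")
  proof
    fix j
    show "?L j = ?R j"
      unfolding cyc_add cyc_diff cyc_smult cyc_shift cyc_bpoly
      using askey_wilson[OF nz, of "cyc q a lam p" j] by (simp add: diff_eq_eq eq_diff_eq add_eq_0_iff) algebra
  qed
qed

end

text \<open>The first two invariants fix B on 1 and X, the other two fix the recursion of
  \<open>bpoly_X_squared\<close>. As it has order two, the induction carries the claim for
  \<open>p\<close> and for \<open>X p\<close> together.\<close>

lemma bpoly_cong:
  fixes q :: "'a::field"
  assumes nz: "q \<noteq> 0" "a \<noteq> 0" "b \<noteq> 0" "c \<noteq> 0" "lam \<noteq> 0"
    and nz': "a' \<noteq> 0" "b' \<noteq> 0" "c' \<noteq> 0" "lam' \<noteq> 0"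
    and inv: "verma_invariants q (a, b, c, lam) = verma_invariants q (a', b', c', lam')"
  shows "bpoly q a b c lam p = bpoly q a' b' c' lam' p"
proof -
  note i = inv[unfolded verma_invariants_eq_iff]
  have t: "lam / b = lam' / b'" using i by (metis inverse_divide)
  let ?G = "\<lambda>p. bpoly q a b c lam p = bpoly q a' b' c' lam' p"
  have add: "?G (p + r)" if "?G p" "?G r" for p r
    using that by (simp add: bpoly_add)
  have const: "?G [:s:]" for s
    using bpoly_smult[of q _ _ _ _ s "[:1:]"] i t by (simp add: bpoly_1)
  have lin: "?G [:0, s:]" for s
    using bpoly_smult[of q a b c lam s "[:0, 1:]"] bpoly_smult[of q a' b' c' lam' s "[:0, 1:]"] i t
    by (simp add: bpoly_X[OF nz] bpoly_X[OF nz(1) nz'])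
  have "?G p \<and> ?G (pCons 0 p)"
  proof (induction p)
    case 0
    show ?case using const[of 0] by simp
  next
    case (pCons s p)
    have X2: "?G (pCons 0 (pCons 0 p))"
      unfolding bpoly_X_squared[OF nz] bpoly_X_squared[OF nz(1) nz'] using pCons.IH i by simp
    have "pCons s p = [:s:] + pCons 0 p" "pCons 0 (pCons s p) = [:0, s:] + pCons 0 (pCons 0 p)"
      by simp_all
    then show ?case using add[OF const[of s]] add[OF lin[of s] X2] pCons.IH by metis
  qed
  then show ?thesis ..
qed

text \<open>\<open>\<phi>\<^sub>1\<close> and the Askey--Wilson relation recover the invariants from the action of \<open>B\<close> on \<open>1\<close>, \<open>X\<close>, \<open>X\<^sup>2\<close>.\<close>
lemma verma_invariants_eqI:
  fixes q :: "'a::field"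
  assumes q: "q - inverse q \<noteq> 0" "q\<^sup>2 - (inverse q)\<^sup>2 \<noteq> 0"
    and nz: "q \<noteq> 0" "a \<noteq> 0" "b \<noteq> 0" "c \<noteq> 0" "lam \<noteq> 0"
    and nz': "a' \<noteq> 0" "b' \<noteq> 0" "c' \<noteq> 0" "lam' \<noteq> 0"
    and eq: "\<And>p. degree p \<le> 2 \<Longrightarrow> bpoly q a b c lam p = bpoly q a' b' c' lam' p"
  shows "verma_invariants q (a, b, c, lam) = verma_invariants q (a', b', c', lam')"
proof -
  have b0: "b / lam + lam / b = b' / lam' + lam' / b'"
    using eq[of "[:1:]"] by (simp add: bpoly_1)
  have b1: "(q - inverse q) * iotaM q a b c lam = (q - inverse q) * iotaM q a' b' c' lam'"
    "b / lam * q\<^sup>2 + lam / b * (inverse q)\<^sup>2 = b' / lam' * q\<^sup>2 + lam' / b' * (inverse q)\<^sup>2"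
    using eq[of "[:0, 1:]"] unfolding bpoly_X[OF nz] bpoly_X[OF nz(1) nz'] by simp_all
  \<comment> \<open>Subtracting \<open>q^(-2)\<close> times the first equation from the second
    separates \<open>b / lam\<close> from its inverse.\<close>
  have "(q\<^sup>2 - (inverse q)\<^sup>2) * (b / lam - b' / lam') = 0" using b0 b1(2) by algebra
  then have t: "b / lam = b' / lam'" using q(2) by simp
  have iota: "iotaM q a b c lam = iotaM q a' b' c' lam'" using b1(1) q(1) by simp
  have cancel: "r - s = r' - s'" if "u - v - w - r + s = u - v - w - r' + s'"
    for u v w r s r' s' :: "'a poly"
    using that by (simp add: algebra_simps)
  have e0: "bpoly q a b c lam [:1:] = bpoly q a' b' c' lam' [:1:]"
    and e1: "bpoly q a b c lam (pCons 0 [:1:]) = bpoly q a' b' c' lam' (pCons 0 [:1:])"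
    and e2: "bpoly q a b c lam (pCons 0 (pCons 0 [:1:])) = bpoly q a' b' c' lam' (pCons 0 (pCons 0 [:1:]))"
    by (intro eq; simp)+
  \<comment> \<open>Of the recursion at \<open>p = 1\<close> only the terms with \<gamma> and
    \<beta> survive, as the coefficients of X and of 1.\<close>
  have "smult ((q - inverse q)\<^sup>2 * gammaM q a b c lam) (pCons 0 [:1:])
    - smult ((q\<^sup>2 - (inverse q)\<^sup>2) * (q - inverse q) * gammaM q c a b lam) [:1:]
    = smult ((q - inverse q)\<^sup>2 * gammaM q a' b' c' lam') (pCons 0 [:1:])
    - smult ((q\<^sup>2 - (inverse q)\<^sup>2) * (q - inverse q) * gammaM q c' a' b' lam') [:1:]"
    using e2 unfolding bpoly_X_squared[OF nz] bpoly_X_squared[OF nz(1) nz'] e0 e1 by (rule cancel)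
  then have "gammaM q a b c lam = gammaM q a' b' c' lam'" "gammaM q c a b lam = gammaM q c' a' b' lam'"
    using q by simp_all
  with t iota show ?thesis by (simp add: verma_invariants_eq_iff)
qed

section \<open>The quotient modules\<close>

definition cpoly :: "'a::field \<Rightarrow> 'a \<Rightarrow> 'a \<Rightarrow> 'a \<Rightarrow> 'a \<Rightarrow> 'a poly \<Rightarrow> 'a poly" where
  "cpoly q a b c lam p =
     smult (gammaM q a b c lam / (q + inverse q)) p
     - smult (1 / (q\<^sup>2 - (inverse q)\<^sup>2))
         (smult q (pCons 0 (bpoly q a b c lam p)) - smult (inverse q) (bpoly q a b c lam (pCons 0 p)))"

lemma cyc_cpoly: "cyc q a lam (cpoly q a b c lam p) = actC q a b c lam (cyc q a lam p)"
  by (simp add: cpoly_def actC_def cyc_diff cyc_smult cyc_shift cyc_bpoly actA_linear)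

lemma cpoly_diff: "cpoly q a b c lam (p - r) = cpoly q a b c lam p - cpoly q a b c lam r"
proof -
  have "pCons 0 (p - r) = pCons 0 p - pCons 0 r" by simp
  then show ?thesis
    unfolding cpoly_def by (simp only: bpoly_diff) (simp add: smult_diff_right)
qed

text \<open>The class of \<open>p(A) m\<^sub>0\<close>; every element of the quotient has this form.\<close>
definition poly_class :: "'a::field \<Rightarrow> 'a \<Rightarrow> 'a \<Rightarrow> 'a \<Rightarrow> 'a poly \<Rightarrow> (nat \<Rightarrow> 'a) set" where
  "poly_class q a lam delta p = qcoset (Nsub q delta) (cyc q a lam p)"

lemma w0_poly_class: "w0 q delta = poly_class q a lam delta [:1:]"
  by (simp add: w0_def poly_class_def cyc_const)

context
  fixes q a lam delta :: "'a::field"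
  assumes q: "(q\<^sup>2) ^ dprime q = 1"
begin

lemma poly_class_eq_image:
  "poly_class q a lam delta p = cyc q a lam ` {r. A_charpoly q a lam delta dvd p - r}"
  unfolding poly_class_def qcoset_def FS_eq_range_cyc[of q a lam]
  by (auto simp: cyc_diff[symmetric] cyc_in_Nsub_iff[OF q])

lemma poly_class_eq_iff:
  "poly_class q a lam delta p = poly_class q a lam delta r \<longleftrightarrow> A_charpoly q a lam delta dvd p - r"
proof
  assume "poly_class q a lam delta p = poly_class q a lam delta r"
  moreover have "cyc q a lam r \<in> poly_class q a lam delta r" by (simp add: poly_class_eq_image)
  ultimately have "cyc q a lam r \<in> poly_class q a lam delta p" by (simp only:)
  then show "A_charpoly q a lam delta dvd p - r"
    by (auto simp: poly_class_eq_image cyc_inject)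
next
  assume d: "A_charpoly q a lam delta dvd p - r"
  have "A_charpoly q a lam delta dvd p - s \<longleftrightarrow> A_charpoly q a lam delta dvd r - s" for s
    using dvd_add_right_iff[OF d, of "r - s"] by simp
  then show "poly_class q a lam delta p = poly_class q a lam delta r"
    by (simp add: poly_class_eq_image)
qed

text \<open>The operations of the quotient act on an arbitrarily chosen representative. It differs
  from \<open>p\<close> by a multiple of P, so each operation only has to respect congruence modulo
  P.\<close>

lemma qrep_poly_class:
  obtains r where "qrep (poly_class q a lam delta p) = cyc q a lam r"
    "A_charpoly q a lam delta dvd p - r"
proof -
  have "cyc q a lam p \<in> poly_class q a lam delta p" by (simp add: poly_class_eq_image)
  then have "qrep (poly_class q a lam delta p) \<in> poly_class q a lam delta p"
    unfolding qrep_def using someI[of "\<lambda>f. f \<in> poly_class q a lam delta p"] by blast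
  then show thesis using that by (auto simp: poly_class_eq_image)
qed

lemma carr_Wmod: "carr (Wmod q a b c lam delta) = range (poly_class q a lam delta)"
  unfolding Wmod_def quot_mod_def FS_eq_range_cyc[of q a lam] poly_class_def by (simp add: image_image)

lemma vadd_Wmod:
  "vadd (Wmod q a b c lam delta) (poly_class q a lam delta p) (poly_class q a lam delta r)
    = poly_class q a lam delta (p + r)"
proof -
  obtain p' where p: "qrep (poly_class q a lam delta p) = cyc q a lam p'" "A_charpoly q a lam delta dvd p - p'"
    by (rule qrep_poly_class)
  obtain r' where r: "qrep (poly_class q a lam delta r) = cyc q a lam r'" "A_charpoly q a lam delta dvd r - r'"
    by (rule qrep_poly_class)
  have "vadd (Wmod q a b c lam delta) (poly_class q a lam delta p) (poly_class q a lam delta r)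
      = poly_class q a lam delta (p' + r')"
    by (simp add: Wmod_def quot_mod_def p(1) r(1)) (simp add: poly_class_def cyc_add)
  also have "\<dots> = poly_class q a lam delta (p + r)"
    unfolding poly_class_eq_iff using dvd_add[OF p(2) r(2)]
    by (metis add_diff_add dvd_diff_commute)
  finally show ?thesis .
qed

lemma vsmul_Wmod:
  "vsmul (Wmod q a b c lam delta) s (poly_class q a lam delta p) = poly_class q a lam delta (smult s p)"
proof -
  obtain p' where p: "qrep (poly_class q a lam delta p) = cyc q a lam p'" "A_charpoly q a lam delta dvd p - p'"
    by (rule qrep_poly_class)
  have "vsmul (Wmod q a b c lam delta) s (poly_class q a lam delta p) = poly_class q a lam delta (smult s p')"
    by (simp add: Wmod_def quot_mod_def p(1)) (simp add: poly_class_def cyc_smult)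
  also have "\<dots> = poly_class q a lam delta (smult s p)"
    unfolding poly_class_eq_iff using dvd_smult[OF p(2), of s]
    by (metis smult_diff_right dvd_diff_commute)
  finally show ?thesis .
qed

lemma opA_Wmod:
  "opA (Wmod q a b c lam delta) (poly_class q a lam delta p) = poly_class q a lam delta (pCons 0 p)"
proof -
  obtain p' where p: "qrep (poly_class q a lam delta p) = cyc q a lam p'" "A_charpoly q a lam delta dvd p - p'"
    by (rule qrep_poly_class)
  have "opA (Wmod q a b c lam delta) (poly_class q a lam delta p) = poly_class q a lam delta (pCons 0 p')"
    by (simp add: Wmod_def quot_mod_def p(1)) (simp add: poly_class_def cyc_shift)
  also have "A_charpoly q a lam delta dvd [:0, 1:] * (p - p')" using p(2) by (rule dvd_mult)
  then have "poly_class q a lam delta (pCons 0 p') = poly_class q a lam delta (pCons 0 p)"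
    unfolding poly_class_eq_iff by (subst dvd_diff_commute) simp
  finally show ?thesis .
qed

context
  fixes b c :: 'a
  assumes nz: "q \<noteq> 0" "a \<noteq> 0" "b \<noteq> 0" "c \<noteq> 0" "lam \<noteq> 0"
begin

text \<open>Under \<open>cyc\<close> the ideal of P is the image of \<open>delta\<close> minus the
  shift, which commutes with B; hence B, and then C, descend to the quotient.\<close>

lemma A_charpoly_dvd_bpoly:
  assumes "A_charpoly q a lam delta dvd p"
  shows "A_charpoly q a lam delta dvd bpoly q a b c lam p"
proof -
  have "cyc q a lam p \<in> Nsub q delta" using assms cyc_in_Nsub_iff[OF q] by blast
  then obtain g where g: "g \<in> FS" "cyc q a lam p = (\<lambda>j. delta * g j + (-1) * shiftd (dprime q) g j)"
    unfolding Nsub_shiftd by auto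
  have "cyc q a lam (bpoly q a b c lam p)
      = (\<lambda>j. delta * actB q a b c lam g j - shiftd (dprime q) (actB q a b c lam g) j)"
    unfolding cyc_bpoly g(2) actB_linear actB_shiftd[OF nz q] by simp
  then have "cyc q a lam (bpoly q a b c lam p) \<in> Nsub q delta"
    unfolding Nsub_shiftd using actB_in_FS[OF g(1)] by blast
  then show ?thesis using cyc_in_Nsub_iff[OF q] by blast
qed

lemma A_charpoly_dvd_cpoly:
  assumes "A_charpoly q a lam delta dvd p"
  shows "A_charpoly q a lam delta dvd cpoly q a b c lam p"
proof -
  have X: "A_charpoly q a lam delta dvd pCons 0 r" if "A_charpoly q a lam delta dvd r" for r
    using dvd_mult[OF that, of "[:0, 1:]"] by simp
  show ?thesis
    unfolding cpoly_def
    by (intro dvd_diff dvd_smult X A_charpoly_dvd_bpoly assms)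
qed

lemma opB_Wmod:
  "opB (Wmod q a b c lam delta) (poly_class q a lam delta p)
    = poly_class q a lam delta (bpoly q a b c lam p)"
proof -
  obtain p' where p: "qrep (poly_class q a lam delta p) = cyc q a lam p'" "A_charpoly q a lam delta dvd p - p'"
    by (rule qrep_poly_class)
  have "opB (Wmod q a b c lam delta) (poly_class q a lam delta p)
      = poly_class q a lam delta (bpoly q a b c lam p')"
    by (simp add: Wmod_def quot_mod_def p(1)) (simp add: poly_class_def cyc_bpoly)
  also have "\<dots> = poly_class q a lam delta (bpoly q a b c lam p)"
    unfolding poly_class_eq_iff using A_charpoly_dvd_bpoly[OF p(2)]
    by (subst dvd_diff_commute) (simp add: bpoly_diff)
  finally show ?thesis .
qed

lemma opC_Wmod:
  "opC (Wmod q a b c lam delta) (poly_class q a lam delta p)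
    = poly_class q a lam delta (cpoly q a b c lam p)"
proof -
  obtain p' where p: "qrep (poly_class q a lam delta p) = cyc q a lam p'" "A_charpoly q a lam delta dvd p - p'"
    by (rule qrep_poly_class)
  have "opC (Wmod q a b c lam delta) (poly_class q a lam delta p)
      = poly_class q a lam delta (cpoly q a b c lam p')"
    by (simp add: Wmod_def quot_mod_def p(1)) (simp add: poly_class_def cyc_cpoly)
  also have "\<dots> = poly_class q a lam delta (cpoly q a b c lam p)"
    unfolding poly_class_eq_iff using A_charpoly_dvd_cpoly[OF p(2)]
    by (subst dvd_diff_commute) (simp add: cpoly_diff)
  finally show ?thesis .
qed

end
end

section \<open>Comparison of two quotient modules\<close>

context
  fixes q a b c lam delta a' b' c' lam' delta' :: "'a::field"
  assumes root: "\<exists>n>0. q ^ n = 1" and ord: "root_order q \<notin> {1, 2, 4}"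
    and nz: "a \<noteq> 0" "b \<noteq> 0" "c \<noteq> 0" "lam \<noteq> 0"
    and nz': "a' \<noteq> 0" "b' \<noteq> 0" "c' \<noteq> 0" "lam' \<noteq> 0"
begin

text \<open>As P and the action of B on F[X] coincide, sending the class of \<open>p\<close> to the
  class of \<open>p\<close> works; C is compatible because it is expressed by A, B and
  \<gamma>.\<close>

lemma tq_iso_if_invariants_eq:
  assumes inv: "verma_invariants q (a, b, c, lam) = verma_invariants q (a', b', c', lam')"
    and P: "A_charpoly q a lam delta = A_charpoly q a' lam' delta'"
  shows "\<exists>h. tq_iso (Wmod q a b c lam delta) (Wmod q a' b' c' lam' delta') h
    \<and> h (w0 q delta) = w0 q delta'"
proof -
  note q = dprime_props(1,3)[OF root ord]
  note n = q(1) nz and n' = q(1) nz'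
  let ?k = "poly_class q a lam delta" and ?k' = "poly_class q a' lam' delta'"
  \<comment> \<open>\<open>SOME\<close> picks a polynomial representing the class; \<open>eq\<close>
    below makes the choice immaterial.\<close>
  define h where "h Z = ?k' (SOME p. Z = ?k p)" for Z
  have eq: "?k p = ?k r \<longleftrightarrow> ?k' p = ?k' r" for p r
    using poly_class_eq_iff[OF q(2)] P by metis
  have h: "h (?k p) = ?k' p" for p
    unfolding h_def using someI[of "\<lambda>r. ?k p = ?k r" p] eq by metis
  have b: "bpoly q a b c lam p = bpoly q a' b' c' lam' p" for p
    by (rule bpoly_cong[OF n nz' inv])
  have c: "cpoly q a b c lam p = cpoly q a' b' c' lam' p" for p
    using inv by (simp add: cpoly_def b verma_invariants_eq_iff)
  note W = carr_Wmod[OF q(2)] vadd_Wmod[OF q(2)] vsmul_Wmod[OF q(2)] opA_Wmod[OF q(2)]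
    opB_Wmod[OF q(2) n] opC_Wmod[OF q(2) n] opB_Wmod[OF q(2) n'] opC_Wmod[OF q(2) n']
  have "tq_hom (Wmod q a b c lam delta) (Wmod q a' b' c' lam' delta') h"
    unfolding tq_hom_def by (simp add: W h b c)
  moreover have "bij_betw h (range ?k) (range ?k')"
    unfolding bij_betw_def inj_on_def by (auto simp: h eq image_iff)
  ultimately have "tq_iso (Wmod q a b c lam delta) (Wmod q a' b' c' lam' delta') h"
    by (simp add: tq_iso_def W)
  moreover have "h (w0 q delta) = w0 q delta'"
    unfolding w0_poly_class[of q delta a lam] w0_poly_class[of q delta' a' lam'] by (rule h)
  ultimately show ?thesis by blast
qed

text \<open>A homomorphism that matches the generators and commutes with A sends the class of
  \<open>p\<close> to the class of \<open>p\<close>. So P lies in the ideal of \<open>?P'\<close>,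
  and the two actions of B agree modulo \<open>?P'\<close>.\<close>

lemma invariants_eq_if_tq_hom:
  assumes hom: "tq_hom (Wmod q a b c lam delta) (Wmod q a' b' c' lam' delta') h"
    and w0: "h (w0 q delta) = w0 q delta'"
  shows "A_charpoly q a lam delta = A_charpoly q a' lam' delta'"
    "verma_invariants q (a, b, c, lam) = verma_invariants q (a', b', c', lam')"
proof -
  note q = dprime_props(1,3)[OF root ord]
  note n = q(1) nz and n' = q(1) nz'
  let ?k = "poly_class q a lam delta" and ?k' = "poly_class q a' lam' delta'"
  let ?P = "A_charpoly q a lam delta" and ?P' = "A_charpoly q a' lam' delta'"
  let ?V = "Wmod q a b c lam delta" and ?V' = "Wmod q a' b' c' lam' delta'"
  note W = carr_Wmod[OF q(2)] vadd_Wmod[OF q(2)] vsmul_Wmod[OF q(2)] opA_Wmod[OF q(2)]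
    opB_Wmod[OF q(2) n] opB_Wmod[OF q(2) n']
  have in_carr: "?k p \<in> carr ?V" for p by (simp add: W)
  have one: "h (?k [:1:]) = ?k' [:1:]"
    using w0 unfolding w0_poly_class[of q delta a lam] w0_poly_class[of q delta' a' lam'] .
  have h_add: "h (?k (p + r)) = vadd ?V' (h (?k p)) (h (?k r))" for p r
    using hom in_carr unfolding tq_hom_def by (metis W(2))
  have h_smult: "h (?k (smult s p)) = vsmul ?V' s (h (?k p))" for s p
    using hom in_carr unfolding tq_hom_def by (metis W(3))
  have h_A: "h (?k (pCons 0 p)) = opA ?V' (h (?k p))" for p
    using hom in_carr unfolding tq_hom_def by (metis W(4))
  have h_B: "h (?k (bpoly q a b c lam p)) = opB ?V' (h (?k p))" for p
    using hom in_carr unfolding tq_hom_def by (metis W(5))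
  have const: "h (?k [:s:]) = ?k' [:s:]" for s
    using h_smult[of s "[:1:]"] by (simp add: one W)
  have h: "h (?k p) = ?k' p" for p
  proof (induction p)
    case 0
    show ?case using const[of 0] by simp
  next
    case (pCons s p)
    have "pCons s p = [:s:] + pCons 0 p" by simp
    then show ?case
      using h_add[of "[:s:]" "pCons 0 p"] by (simp add: const h_A pCons.IH W)
  qed
  have d3: "3 \<le> dprime q" by (rule dprime_props(2)[OF root ord])
  have "?k ?P = ?k 0" unfolding poly_class_eq_iff[OF q(2)] by simp
  then have "?k' ?P = ?k' 0" using h by metis
  then have "?P' dvd ?P" unfolding poly_class_eq_iff[OF q(2)] by simp
  \<comment> \<open>Both polynomials are monic of the same degree, so the cofactor is 1.\<close>
  then obtain r where r: "?P = ?P' * r" by (elim dvdE)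
  have monic: "degree ?P = dprime q" "lead_coeff ?P = 1" "degree ?P' = dprime q" "lead_coeff ?P' = 1"
    using A_charpoly_monic[of q] d3 by simp_all
  then have "?P' \<noteq> 0" "r \<noteq> 0" using r by auto
  then have "degree r = 0" using r monic(1,3) by (simp add: degree_mult_eq)
  moreover have "lead_coeff r = 1" using r monic(2,4) by (metis lead_coeff_mult mult_1)
  ultimately have "r = 1" by (auto elim!: degree_eq_zeroE simp: one_pCons)
  then show P: "?P = ?P'" using r by simp
  show "verma_invariants q (a, b, c, lam) = verma_invariants q (a', b', c', lam')"
  proof (rule verma_invariants_eqI[OF q_nondegenerate(2,3)[OF root ord] n nz'])
    fix p :: "'a poly"
    assume p: "degree p \<le> 2"
    have "?k' (bpoly q a b c lam p) = ?k' (bpoly q a' b' c' lam' p)"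
      using h_B[of p] by (simp add: h W)
    then have "?P' dvd bpoly q a b c lam p - bpoly q a' b' c' lam' p"
      unfolding poly_class_eq_iff[OF q(2)] .
    \<comment> \<open>The difference has degree at most 2, while \<open>?P'\<close> has degree at
      least 3, so congruence is equality.\<close>
    moreover have "degree (bpoly q a b c lam p - bpoly q a' b' c' lam' p) \<le> 2"
      using p degree_bpoly_le order_trans by (intro degree_diff_le) blast+
    ultimately show "bpoly q a b c lam p = bpoly q a' b' c' lam' p"
      using d3 monic(3) dvd_imp_degree_le[of ?P' "bpoly q a b c lam p - bpoly q a' b' c' lam' p"]
      by fastforce
  qed
qed

end

theorem theorem7p4:
  fixes q a b c lam delta a' b' c' lam' delta' :: "'a::field"
  assumes alg_closed: "\<forall>p::'a poly. 0 < degree p \<longrightarrow> (\<exists>x. poly p x = 0)"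
    and root: "\<exists>n>0. q ^ n = 1"
    and ord: "root_order q \<notin> {1, 2, 4}"
    and nz: "a \<noteq> 0" "b \<noteq> 0" "c \<noteq> 0" "lam \<noteq> 0"
    and nz': "a' \<noteq> 0" "b' \<noteq> 0" "c' \<noteq> 0" "lam' \<noteq> 0"
  shows "(pmS4_equiv q (a, b, c, lam, delta) (a', b', c', lam', delta')
            \<longleftrightarrow> (\<exists>h. tq_hom (Wmod q a b c lam delta) (Wmod q a' b' c' lam' delta') h
                      \<and> h (w0 q delta) = w0 q delta'))
       \<and> (pmS4_equiv q (a, b, c, lam, delta) (a', b', c', lam', delta')
            \<longleftrightarrow> (\<exists>h. tq_hom (Wmod q a' b' c' lam' delta') (Wmod q a b c lam delta) h
                      \<and> h (w0 q delta') = w0 q delta))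
       \<and> (pmS4_equiv q (a, b, c, lam, delta) (a', b', c', lam', delta')
            \<longleftrightarrow> (\<exists>h. tq_iso (Wmod q a b c lam delta) (Wmod q a' b' c' lam' delta') h
                      \<and> h (w0 q delta) = w0 q delta'))
       \<and> (pmS4_equiv q (a, b, c, lam, delta) (a', b', c', lam', delta')
            \<longleftrightarrow> (\<exists>h. tq_iso (Wmod q a' b' c' lam' delta') (Wmod q a b c lam delta) h
                      \<and> h (w0 q delta') = w0 q delta))"
proof -
  note q = dprime_props(1)[OF root ord] and n = q_nondegenerate[OF root ord]
  let ?V = "Wmod q a b c lam delta" and ?V' = "Wmod q a' b' c' lam' delta'"
  let ?E = "pmS4_equiv q (a, b, c, lam, delta) (a', b', c', lam', delta')"
  \<comment> \<open>Condition (i) becomes two equalities symmetric in the two tuples, so the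
    statements with domain and codomain exchanged follow from the same lemmas.\<close>
  have E: "?E \<longleftrightarrow>
      verma_invariants q (a, b, c, lam) = verma_invariants q (a', b', c', lam') \<and>
      A_charpoly q a lam delta = A_charpoly q a' lam' delta'"
    unfolding pmS4_equiv_def prod.case s4steps_iff_verma_invariants[OF alg_closed q n(1) nz nz']
      A_charpoly_eq_iff[OF alg_closed root ord nz(1,4) nz'(1,4)] ..
  have hom: ?E if "tq_hom ?V ?V' h" "h (w0 q delta) = w0 q delta'" for h
    unfolding E using invariants_eq_if_tq_hom[OF root ord nz nz' that] by blast
  have hom': ?E if "tq_hom ?V' ?V h" "h (w0 q delta') = w0 q delta" for h
    unfolding E using invariants_eq_if_tq_hom[OF root ord nz' nz that] by simp
  have iso: "\<exists>h. tq_iso ?V ?V' h \<and> h (w0 q delta) = w0 q delta'"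
    and iso': "\<exists>h. tq_iso ?V' ?V h \<and> h (w0 q delta') = w0 q delta" if ?E
    using that tq_iso_if_invariants_eq[OF root ord nz nz'] tq_iso_if_invariants_eq[OF root ord nz' nz]
    unfolding E by simp_all
  show ?thesis
    using hom hom' iso iso' unfolding tq_iso_def by blast
qed

end
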